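(* Consider concave kite central configurations of the planar Newtonian 4-body problem with two pairs of equal masses, where $m_1=m_2=1$ lie at the endpoints of the base of an isosceles triangle and $m_3=m_4=m>0$ lie on the symmetry axis of the base (with one of them inside the triangle formed by the other three). Then, counting configurations up to equivalence, (1) there are precisely two such concave kite central configurations if $m\in(0,m_0)$; (2) there is exactly one if $m=m_0$; (3) there is none if $m>m_0$, where $m_0\approx 1.002713329037083$ is a specific constant. Furthermore, if $m=0$ is admitted, there are exactly two such configurations; in both, $m_1,m_2,m_4$ form an equilateral triangle (which is the convex hull), and $m_3$ is located either at the midpoint of $m_1$ and $m_2$, or coincides with $m_4$.
   Context: Bodies with masses $m_i$ at positions $q_i\in\mathbb{R}^2$, $i=1,\dots,4$, with $r_{ij}=|q_i-q_j|$. A configuration is a central configuration if there is a constant $\lambda$ with $-\lambda m_j(q_j-c)=\sum_{i\neq j} m_im_j(q_i-q_j)/r_{ij}^3$ for all $j$, where $c=\sum m_iq_i/\sum m_i$. Two central configurations are equivalent if they differ by translation, dilation and rotation. A non-collinear configuration is a kite if it has a symmetry axis through two of the bodies; it is concave if one body lies inside the triangle formed by the other three.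
   Formalization: For m=0 the central configuration equations are divided by m_j, massless bodies exert no force and may coincide, and m_3 may lie on the boundary of the triangle; configurations are counted with bodies of equal mass interchangeable (m_3 taken as the inner one). *)

theory Defs
  imports "HOL-Analysis.Analysis"
begin

definition bodies :: "nat set" where
  "bodies = {1, 2, 3, 4}"

definition center_of_mass :: "(nat \<Rightarrow> real) \<Rightarrow> (nat \<Rightarrow> complex) \<Rightarrow> complex" where
  "center_of_mass m q =
     (\<Sum>i\<in>bodies. of_real (m i) * q i) / of_real (\<Sum>i\<in>bodies. m i)"

definition central_configuration :: "(nat \<Rightarrow> real) \<Rightarrow> (nat \<Rightarrow> complex) \<Rightarrow> bool" where
  "central_configuration m q \<longleftrightarrow>
     (\<forall>i\<in>bodies. \<forall>j\<in>bodies. i \<noteq> j \<longrightarrow> q i \<noteq> q j) \<and>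
     (\<exists>lam::real. \<forall>j\<in>bodies.
        - of_real (lam * m j) * (q j - center_of_mass m q) =
        (\<Sum>i\<in>bodies - {j}. of_real (m i * m j / (cmod (q i - q j)) ^ 3) * (q i - q j)))"

text \<open>Version admitting massless bodies (used only for the case m = 0): the equation of
  body j is divided by m_j (so it is the restricted-problem equation for massless bodies),
  massless bodies exert no force, and only collisions between two massless bodies
  are allowed.  For positive masses this is equivalent to central_configuration.\<close>
definition central_configuration0 :: "(nat \<Rightarrow> real) \<Rightarrow> (nat \<Rightarrow> complex) \<Rightarrow> bool" where
  "central_configuration0 m q \<longleftrightarrow>
     (\<forall>i\<in>bodies. \<forall>j\<in>bodies. i \<noteq> j \<and> (m i \<noteq> 0 \<or> m j \<noteq> 0) \<longrightarrow> q i \<noteq> q j) \<and>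
     (\<exists>lam::real. \<forall>j\<in>bodies.
        - of_real lam * (q j - center_of_mass m q) =
        (\<Sum>i\<in>{i\<in>bodies - {j}. m i \<noteq> 0}. of_real (m i / (cmod (q i - q j)) ^ 3) * (q i - q j)))"

definition kite_masses :: "real \<Rightarrow> nat \<Rightarrow> real" where
  "kite_masses m i = (if i = 1 \<or> i = 2 then 1 else if i = 3 \<or> i = 4 then m else 0)"

text \<open>Normal form of a kite with symmetry axis through bodies 3 and 4: every such
  configuration is equivalent (translation, rotation, dilation, together with the
  relabelling m_1 <-> m_2 of the equal masses, i.e. the mirror image) to exactly one
  with q_1 = (-1,0), q_2 = (1,0), q_3 = (0,a), q_4 = (0,b), b > 0.\<close>
definition kite_config :: "real \<Rightarrow> real \<Rightarrow> nat \<Rightarrow> complex" where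
  "kite_config a b i =
     (if i = 1 then -1 else if i = 2 then 1 else if i = 3 then \<i> * of_real a
      else if i = 4 then \<i> * of_real b else 0)"

definition concave_kite_ccs :: "real \<Rightarrow> (real \<times> real) set" where
  "concave_kite_ccs m = {(a, b). b > 0 \<and>
     kite_config a b 3 \<in> interior (convex hull {kite_config a b 1, kite_config a b 2, kite_config a b 4}) \<and>
     central_configuration (kite_masses m) (kite_config a b)}"

definition concave_kite_ccs0 :: "(real \<times> real) set" where
  "concave_kite_ccs0 = {(a, b). b > 0 \<and>
     kite_config a b 3 \<in> convex hull {kite_config a b 1, kite_config a b 2, kite_config a b 4} \<and>
     central_configuration0 (kite_masses 0) (kite_config a b)}"

end

theory Submission
  imports Defs
begin

text \<open>
  For a kite with q1, q2 = (-1, 0), (1, 0), q3 = (0, a), q4 = (0, b) put d = b - a and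
  fl x = x (rho x - 1/8) with rho x = (1 + x^2)^(-3/2).  The equations of a central configuration reduce to
  m d (d^(-3) - rho b) = 2 fl a and m d (rho a - d^(-3)) = 2 fl b.  Eliminating m gives one
  equation kcurve a b = 0.  At each of its zeros the derivative with respect to b is positive, so it
  defines a curve b = phi a over 0 < a < sqrt 3, on which the ratio nu a = 2 / m tends to infinity at both ends.
  The derivative of nu has the sign of a Jacobian determinant jac.  This is negative to the left and
  positive to the right of a single point near 0.6138576: by hand estimates near the two ends, by
  interval arithmetic on a few boxes in the middle, and, on the box where it vanishes, because its own derivative
  is positive at each zero.  So nu is first strictly decreasing and then strictly increasing; each level above
  the minimum is attained twice, and m0 is 2 divided by the minimum.
\<close>

section \<open>Zero crossings and implicit functions\<close>

text \<open>\<open>rho x\<close> is the inverse cubed distance from (0, x) to the base bodies and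
  1/8 that between the base bodies themselves; \<open>sqrt 3\<close> is the height at which the
  triangle over the base is equilateral. The obstacle is that monotonicity of \<open>kcurve\<close>
  in \<open>b\<close> or of \<open>jac\<close> along the curve is not at hand: only the sign of the
  derivative at zeros is. That is enough, since a continuous function whose crossings all go upwards
  has at most one zero and is positive after it; this is applied once in \<open>b\<close> for fixed
  \<open>a\<close> and once along the curve. The ends need estimates by hand because
  \<open>fl a\<close> tends to 0 at both, so a box touching an end has no positive lower bound for
  the divisor in \<open>nu\<close>. The digits of m0 rest on the flatness of \<open>nu\<close> at
  its minimum: the minimum point is only known to 10^-9, but between two rational points around it
  the derivative of \<open>nu\<close> is at most 2 * 10^-8, so one very precise value of
  \<open>nu\<close> at a rational point gives the minimum up to 2 * 10^-17.\<close>

lemma pos_after_zero: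
  fixes g :: "real \<Rightarrow> real"
  assumes cont: "continuous_on {x..y} g"
    and der: "\<And>z. x \<le> z \<Longrightarrow> z \<le> y \<Longrightarrow> g z = 0 \<Longrightarrow> \<exists>D>0. (g has_real_derivative D) (at z)"
    and "x < y" and "0 \<le> g x"
  shows "0 < g y"
proof (rule ccontr)
  assume neg: "\<not> 0 < g y"
  \<comment> \<open>A zero at the left end is escaped by a small step to the right, where
    \<open>g\<close> is already positive.\<close>
  obtain x1 where x1: "x \<le> x1" "x1 < y" "0 < g x1"
  proof (cases "g x = 0")
    case True
    then obtain D where "D > 0" "(g has_real_derivative D) (at x)"
      using der[of x] \<open>x < y\<close> by auto
    then obtain e where "e > 0" and e: "\<And>h. 0 < h \<Longrightarrow> h < e \<Longrightarrow> g x < g (x + h)"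
      using DERIV_pos_inc_right by blast
    show ?thesis
      using that[of "x + min e (y - x) / 2"] e[of "min e (y - x) / 2"] \<open>e > 0\<close> \<open>x < y\<close> True
      by (auto simp: min_def field_simps split: if_splits)
  qed (use that[of x] \<open>x < y\<close> \<open>0 \<le> g x\<close> in auto)
  have cont1: "continuous_on {x1..w} g" if "w \<le> y" for w
    by (rule continuous_on_subset[OF cont]) (use x1 that in auto)
  \<comment> \<open>The infimum of \<open>Z\<close> is the first zero after \<open>x1\<close>. The
    positive derivative makes \<open>g\<close> negative just before it, and the intermediate value
    theorem then yields a still earlier zero.\<close>
  define Z where "Z = {z \<in> {x1..y}. g z = 0}"
  have "Z \<noteq> {}"
    using IVT2'[of g y 0 x1] x1 neg cont1[of y] by (auto simp: Z_def)
  moreover have "closed Z"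
    unfolding Z_def using continuous_closed_preimage_constant[OF cont1[of y]] by auto
  moreover have bdd: "bdd_below Z"
    unfolding Z_def by (rule bdd_belowI[of _ x1]) auto
  ultimately have z: "Inf Z \<in> Z"
    by (intro closed_contains_Inf)
  define z where "z = Inf Z"
  have "z \<in> Z"
    using z by (simp add: z_def)
  then have z': "x1 < z" "z \<le> y" "g z = 0"
    using x1 by (auto simp: Z_def less_le)
  then obtain D where "D > 0" "(g has_real_derivative D) (at z)"
    using der[of z] x1 by auto
  then obtain e where "e > 0" and e: "\<And>h. 0 < h \<Longrightarrow> h < e \<Longrightarrow> g (z - h) < g z"
    using DERIV_pos_inc_left by blast
  define w where "w = z - min e (z - x1) / 2"
  have w: "x1 < w" "w < z" "g w < 0"
    using e[of "min e (z - x1) / 2"] \<open>e > 0\<close> z'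
    by (auto simp: w_def min_def field_simps split: if_splits)
  then obtain v where "x1 \<le> v" "v \<le> w" "g v = 0"
    using IVT2'[of g w 0 x1] x1 cont1[of w] z' by auto
  then have "v \<in> Z"
    using w z' by (auto simp: Z_def)
  then have "z \<le> v"
    using bdd by (auto simp: z_def intro: cInf_lower)
  then show False
    using \<open>v \<le> w\<close> w by simp
qed

text \<open>Differentiation of an implicit function already known to be continuous. Applying the
  mean value theorem in \<open>y\<close> only, \<open>- F x (\<phi> a)\<close> equals
  \<open>Fy x (\<eta> x) * (\<phi> x - \<phi> a)\<close> with \<open>\<eta> x\<close> squeezed
  towards \<open>\<phi> a\<close>; so in \<open>x\<close> a derivative at the single point
  \<open>a\<close> suffices.\<close>

lemma has_real_derivative_implicit:
  fixes F Fy :: "real \<Rightarrow> real \<Rightarrow> real" and \<phi> :: "real \<Rightarrow> real"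
  assumes zero: "\<forall>\<^sub>F x in nhds a. F x (\<phi> x) = 0"
    and dery: "\<forall>\<^sub>F x in nhds a. \<forall>y. min (\<phi> a) (\<phi> x) \<le> y \<longrightarrow> y \<le> max (\<phi> a) (\<phi> x) \<longrightarrow>
                 (F x has_real_derivative Fy x y) (at y)"
    and cont: "isCont (\<lambda>(x, y). Fy x y) (a, \<phi> a)"
    and cont\<phi>: "isCont \<phi> a"
    and derx: "((\<lambda>x. F x (\<phi> a)) has_real_derivative Fx) (at a)"
    and nz: "Fy a (\<phi> a) \<noteq> 0"
  shows "(\<phi> has_real_derivative (- Fx / Fy a (\<phi> a))) (at a)"
proof -
  \<comment> \<open>The differentiability assumption sits inside the existential as an implication,
    so that an intermediate point can be chosen for every \<open>x\<close>, including those far from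
    \<open>a\<close>.\<close>
  have "\<forall>x. \<exists>z. min (\<phi> a) (\<phi> x) \<le> z \<and> z \<le> max (\<phi> a) (\<phi> x) \<and>
      ((\<forall>y. min (\<phi> a) (\<phi> x) \<le> y \<longrightarrow> y \<le> max (\<phi> a) (\<phi> x) \<longrightarrow>
                 (F x has_real_derivative Fy x y) (at y)) \<longrightarrow>
       F x (\<phi> x) - F x (\<phi> a) = Fy x z * (\<phi> x - \<phi> a))"
  proof
    fix x
    show "\<exists>z. min (\<phi> a) (\<phi> x) \<le> z \<and> z \<le> max (\<phi> a) (\<phi> x) \<and>
      ((\<forall>y. min (\<phi> a) (\<phi> x) \<le> y \<longrightarrow> y \<le> max (\<phi> a) (\<phi> x) \<longrightarrow>
                 (F x has_real_derivative Fy x y) (at y)) \<longrightarrow>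
       F x (\<phi> x) - F x (\<phi> a) = Fy x z * (\<phi> x - \<phi> a))"
    proof (cases "\<forall>y. min (\<phi> a) (\<phi> x) \<le> y \<longrightarrow> y \<le> max (\<phi> a) (\<phi> x) \<longrightarrow>
                 (F x has_real_derivative Fy x y) (at y)")
      case True
      consider "\<phi> a < \<phi> x" | "\<phi> x < \<phi> a" | "\<phi> x = \<phi> a" by linarith
      then show ?thesis
      proof cases
        case 1
        then obtain z where "\<phi> a < z" "z < \<phi> x" "F x (\<phi> x) - F x (\<phi> a) = (\<phi> x - \<phi> a) * Fy x z"
          using MVT2[of "\<phi> a" "\<phi> x" "F x" "Fy x"] True by auto
        then show ?thesis
          by (intro exI[of _ z]) (auto simp: algebra_simps)
      next
        case 2
        then obtain z where "\<phi> x < z" "z < \<phi> a" "F x (\<phi> a) - F x (\<phi> x) = (\<phi> a - \<phi> x) * Fy x z"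
          using MVT2[of "\<phi> x" "\<phi> a" "F x" "Fy x"] True by auto
        then show ?thesis
          by (intro exI[of _ z]) (auto simp: algebra_simps)
      qed auto
    qed auto
  qed
  then obtain \<eta> where \<eta>: "\<And>x. min (\<phi> a) (\<phi> x) \<le> \<eta> x \<and> \<eta> x \<le> max (\<phi> a) (\<phi> x)"
    and mvt: "\<And>x. (\<forall>y. min (\<phi> a) (\<phi> x) \<le> y \<longrightarrow> y \<le> max (\<phi> a) (\<phi> x) \<longrightarrow>
                 (F x has_real_derivative Fy x y) (at y)) \<Longrightarrow>
       F x (\<phi> x) - F x (\<phi> a) = Fy x (\<eta> x) * (\<phi> x - \<phi> a)"
    by metis
  have \<phi>lim: "\<phi> \<midarrow>a\<rightarrow> \<phi> a"
    using cont\<phi> by (simp add: isCont_def)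
  have "\<eta> \<midarrow>a\<rightarrow> \<phi> a"
  proof (rule tendsto_sandwich)
    show "((\<lambda>x. min (\<phi> a) (\<phi> x)) \<longlongrightarrow> \<phi> a) (at a)"
      using tendsto_min[OF tendsto_const[of "\<phi> a"] \<phi>lim] by simp
    show "((\<lambda>x. max (\<phi> a) (\<phi> x)) \<longlongrightarrow> \<phi> a) (at a)"
      using tendsto_max[OF tendsto_const[of "\<phi> a"] \<phi>lim] by simp
  qed (use \<eta> in auto)
  then have lim: "((\<lambda>x. (x, \<eta> x)) \<longlongrightarrow> (a, \<phi> a)) (at a)"
    by (intro tendsto_intros)
  have w: "((\<lambda>x. Fy x (\<eta> x)) \<longlongrightarrow> Fy a (\<phi> a)) (at a)"
    using isCont_tendsto_compose[OF cont lim] by simp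
  have F0: "F a (\<phi> a) = 0"
    using eventually_nhds_x_imp_x[OF zero] .
  have u: "((\<lambda>x. (F x (\<phi> a) - F a (\<phi> a)) / (x - a)) \<longlongrightarrow> Fx) (at a)"
    using derx by (simp add: has_field_derivative_iff)
  have ev: "\<forall>\<^sub>F x in at a. - ((F x (\<phi> a) - F a (\<phi> a)) / (x - a)) / Fy x (\<eta> x) = (\<phi> x - \<phi> a) / (x - a)"
  proof -
    have "\<forall>\<^sub>F x in at a. Fy x (\<eta> x) \<noteq> 0"
      using tendsto_imp_eventually_ne[OF w nz] .
    moreover have "\<forall>\<^sub>F x in at a. F x (\<phi> x) = 0"
      using zero eventually_nhds_conv_at by auto
    moreover have "\<forall>\<^sub>F x in at a. \<forall>y. min (\<phi> a) (\<phi> x) \<le> y \<longrightarrow> y \<le> max (\<phi> a) (\<phi> x) \<longrightarrow>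
                 (F x has_real_derivative Fy x y) (at y)"
      using dery eventually_nhds_conv_at by auto
    moreover have "\<forall>\<^sub>F x in at a. x \<noteq> a"
      by (simp add: eventually_at_filter)
    ultimately show ?thesis
    proof eventually_elim
      case (elim x)
      then show ?case
        using mvt[of x] F0 by (simp add: field_simps)
    qed
  qed
  have "((\<lambda>x. - ((F x (\<phi> a) - F a (\<phi> a)) / (x - a)) / Fy x (\<eta> x)) \<longlongrightarrow> - Fx / Fy a (\<phi> a)) (at a)"
    by (intro tendsto_intros u w nz)
  then have "((\<lambda>x. (\<phi> x - \<phi> a) / (x - a)) \<longlongrightarrow> - Fx / Fy a (\<phi> a)) (at a)"
    using ev by (rule Lim_transform_eventually)
  then show ?thesis
    by (simp add: has_field_derivative_iff)
qed

section \<open>The kite curve\<close>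

definition rho :: "real \<Rightarrow> real" where
  "rho x = 1 / sqrt (1 + x\<^sup>2) ^ 3"

text \<open>Minus the derivative of \<open>rho\<close>, so that it is positive for positive
  arguments.\<close>

definition gam :: "real \<Rightarrow> real" where
  "gam x = 3 * x * rho x / (1 + x\<^sup>2)"

definition gam' :: "real \<Rightarrow> real" where
  "gam' x = 3 * (1 - 4 * x\<^sup>2) * rho x / (1 + x\<^sup>2)\<^sup>2"

definition fl :: "real \<Rightarrow> real" where
  "fl x = x * (rho x - 1 / 8)"

definition fl' :: "real \<Rightarrow> real" where
  "fl' x = rho x * (1 - 2 * x\<^sup>2) / (1 + x\<^sup>2) - 1 / 8"

definition fl'' :: "real \<Rightarrow> real" where
  "fl'' x = 3 * x * (2 * x\<^sup>2 - 3) * rho x / (1 + x\<^sup>2)\<^sup>2"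

lemma one_plus_sq_pos: "0 < 1 + (x::real)\<^sup>2"
  by (simp add: add_pos_nonneg)

lemma rho_pos: "0 < rho x"
  by (simp add: rho_def one_plus_sq_pos)

lemma rho_sq: "(rho x)\<^sup>2 * (1 + x\<^sup>2) ^ 3 = 1"
proof -
  have "(sqrt (1 + x\<^sup>2) ^ 3)\<^sup>2 = (1 + x\<^sup>2) ^ 3"
    using power_mult[of "sqrt (1 + x\<^sup>2)" 2 3] power_mult[of "sqrt (1 + x\<^sup>2)" 3 2] one_plus_sq_pos[of x]
    by simp
  then show ?thesis
    using one_plus_sq_pos[of x] by (simp add: rho_def power_divide)
qed

text \<open>By \<open>rho_sq\<close>, a bound on \<open>rho\<close> at a rational point becomes a
  polynomial inequality between rationals. All numerical information on \<open>rho\<close> enters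
  through this lemma and the next one.\<close>

lemma rho_le:
  assumes "0 \<le> u" "1 \<le> u\<^sup>2 * (1 + x\<^sup>2) ^ 3" shows "rho x \<le> u"
proof -
  have "(rho x)\<^sup>2 * (1 + x\<^sup>2) ^ 3 \<le> u\<^sup>2 * (1 + x\<^sup>2) ^ 3"
    using assms rho_sq by simp
  then have "(rho x)\<^sup>2 \<le> u\<^sup>2"
    using one_plus_sq_pos[of x] by (simp del: power_strict_mono)
  then show ?thesis
    using assms(1) power2_le_imp_le by blast
qed

lemma le_rho:
  assumes "u\<^sup>2 * (1 + x\<^sup>2) ^ 3 \<le> 1" shows "u \<le> rho x"
proof -
  have "u\<^sup>2 * (1 + x\<^sup>2) ^ 3 \<le> (rho x)\<^sup>2 * (1 + x\<^sup>2) ^ 3"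
    using assms rho_sq by simp
  then have "u\<^sup>2 \<le> (rho x)\<^sup>2"
    using one_plus_sq_pos[of x] by (simp del: power_strict_mono)
  then show ?thesis
    using rho_pos[of x] power2_le_imp_le less_imp_le by blast
qed

lemma rho_less_iff:
  assumes "0 \<le> x" "0 \<le> y" shows "rho y < rho x \<longleftrightarrow> x < y"
proof -
  have *: "rho y < rho x" if "0 \<le> x" "x < y" for x y
    using that unfolding rho_def
    by (intro divide_strict_left_mono power_strict_mono real_sqrt_less_mono)
      (auto simp: one_plus_sq_pos power_strict_mono intro!: mult_pos_pos zero_less_power)
  show ?thesis
    using *[of x y] *[of y x] assms by (cases x y rule: linorder_cases) auto
qed

lemma rho_sqrt3: "rho (sqrt 3) = 1 / 8"
  by (simp add: rho_def power3_eq_cube)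

lemma has_derivative_rho: "(rho has_real_derivative - gam x) (at x)"
proof -
  define s where "s = sqrt (1 + x\<^sup>2)"
  have s: "s > 0" "1 + x\<^sup>2 = s\<^sup>2"
    by (auto simp: s_def one_plus_sq_pos)
  have "((\<lambda>x. 1 / sqrt (1 + x\<^sup>2) ^ 3) has_real_derivative
      - (3 * s\<^sup>2 * (x / s)) / (s ^ 3)\<^sup>2) (at x)"
    using s one_plus_sq_pos[of x]
    by (auto intro!: derivative_eq_intros simp: s_def[symmetric] power2_eq_square divide_simps)
  moreover have "- (3 * s\<^sup>2 * (x / s)) / (s ^ 3)\<^sup>2 = - gam x"
    using s by (simp add: gam_def rho_def s_def[symmetric] field_simps power2_eq_square power3_eq_cube)
  ultimately show ?thesis
    by (simp add: rho_def[abs_def])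
qed

lemma gam_altdef: "x * gam x = 3 * rho x - 3 * rho x / (1 + x\<^sup>2)"
  using one_plus_sq_pos[of x] by (simp add: gam_def field_simps power2_eq_square)

lemma fl'_altdef: "fl' x = rho x - x * gam x - 1 / 8"
  using one_plus_sq_pos[of x] by (simp add: fl'_def gam_def field_simps power2_eq_square)

lemma has_derivative_gam: "(gam has_real_derivative gam' x) (at x)"
proof -
  note [derivative_intros] = has_derivative_rho[THEN DERIV_chain2]
  have nz: "1 + x\<^sup>2 \<noteq> 0"
    using one_plus_sq_pos[of x] by simp
  show ?thesis
    unfolding gam_def[abs_def] gam'_def
    using nz by (auto intro!: derivative_eq_intros simp: gam_def divide_simps)
     (simp add: algebra_simps power2_eq_square)
qed

lemma has_derivative_fl: "(fl has_real_derivative fl' x) (at x)"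
  unfolding fl_def[abs_def] fl'_altdef
  by (auto intro!: derivative_eq_intros has_derivative_rho[THEN DERIV_chain2])

lemma has_derivative_fl': "(fl' has_real_derivative fl'' x) (at x)"
proof -
  have nz: "1 + x\<^sup>2 \<noteq> 0"
    using one_plus_sq_pos[of x] by simp
  have "((\<lambda>x. rho x - x * gam x - 1 / 8) has_real_derivative (- 2 * gam x - x * gam' x)) (at x)"
    by (auto intro!: derivative_eq_intros has_derivative_rho[THEN DERIV_chain2] has_derivative_gam[THEN DERIV_chain2])
  moreover have "- 2 * gam x - x * gam' x = fl'' x"
    using nz unfolding gam_def gam'_def fl''_def
    by (simp add: divide_simps) (simp add: algebra_simps power2_eq_square)
  ultimately show ?thesis
    by (simp add: fl'_altdef[abs_def])
qed

lemma fl_sign: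
  assumes "0 < x"
  shows "0 < fl x \<longleftrightarrow> x < sqrt 3" "fl x < 0 \<longleftrightarrow> sqrt 3 < x" "fl x = 0 \<longleftrightarrow> x = sqrt 3"
proof -
  have *: "1 / 8 < rho x \<longleftrightarrow> x < sqrt 3" "rho x < 1 / 8 \<longleftrightarrow> sqrt 3 < x"
    using rho_less_iff[of x "sqrt 3"] rho_less_iff[of "sqrt 3" x] assms by (auto simp: rho_sqrt3)
  show "0 < fl x \<longleftrightarrow> x < sqrt 3" "fl x < 0 \<longleftrightarrow> sqrt 3 < x"
    using * assms by (auto simp: fl_def zero_less_mult_iff mult_less_0_iff)
  then show "fl x = 0 \<longleftrightarrow> x = sqrt 3"
    by linarith
qed

lemma gam_pos: "0 < x \<Longrightarrow> 0 < gam x"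
  by (simp add: gam_def rho_pos one_plus_sq_pos)

text \<open>\<open>sqrt (1 + x\<^sup>2)\<close> exceeds \<open>x\<close> and hence \<open>d\<close>.
  With \<open>d = b - a\<close> and \<open>x = b\<close>: body 4 is nearer to body 3 than to the
  base bodies.\<close>

lemma rho_less_inverse_cube:
  assumes "0 < d" "d \<le> x" shows "rho x < 1 / d ^ 3"
proof -
  have "sqrt (d\<^sup>2) < sqrt (1 + x\<^sup>2)"
    using assms power_mono[of d x 2] by (intro real_sqrt_less_mono) linarith
  then have "d < sqrt (1 + x\<^sup>2)"
    using assms by simp
  then show ?thesis
    unfolding rho_def using assms
    by (intro divide_strict_left_mono power_strict_mono) (auto intro!: mult_pos_pos simp: one_plus_sq_pos)
qed

text \<open>The zeros of kcurve are the pairs (a, b) for which the two equations of the kite are solvable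
  for a common m.\<close>

definition kcurve :: "real \<Rightarrow> real \<Rightarrow> real" where
  "kcurve a b = fl a * (rho a - 1 / (b - a) ^ 3) + fl b * (rho b - 1 / (b - a) ^ 3)"

definition kcurve_a :: "real \<Rightarrow> real \<Rightarrow> real" where
  "kcurve_a a b = fl' a * (rho a - 1 / (b - a) ^ 3) - fl a * gam a - 3 / (b - a) ^ 4 * (fl a + fl b)"

definition kcurve_b :: "real \<Rightarrow> real \<Rightarrow> real" where
  "kcurve_b a b = fl' b * (rho b - 1 / (b - a) ^ 3) - fl b * gam b + 3 / (b - a) ^ 4 * (fl a + fl b)"

lemmas chain_intros = has_derivative_rho[THEN DERIV_chain2] has_derivative_gam[THEN DERIV_chain2]
  has_derivative_fl[THEN DERIV_chain2] has_derivative_fl'[THEN DERIV_chain2]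

lemma has_derivative_kcurve_b:
  assumes "a < b" shows "((\<lambda>b. kcurve a b) has_real_derivative kcurve_b a b) (at b)"
proof -
  define E where "E b = 1 / (b - a) ^ 3" for b
  have E: "(E has_real_derivative - (3 / (b - a) ^ 4)) (at b)"
    using assms unfolding E_def[abs_def]
    by (auto intro!: derivative_eq_intros simp: divide_simps eval_nat_numeral)
  have "((\<lambda>b. fl a * (rho a - E b) + fl b * (rho b - E b)) has_real_derivative kcurve_b a b) (at b)"
    unfolding kcurve_b_def E_def[symmetric]
    by (rule derivative_eq_intros E chain_intros refl)+ (simp add: algebra_simps add_divide_distrib)
  then show ?thesis
    by (simp add: kcurve_def E_def)
qed

lemma has_derivative_kcurve_a:
  assumes "a < b" shows "((\<lambda>a. kcurve a b) has_real_derivative kcurve_a a b) (at a)"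
proof -
  define E where "E a = 1 / (b - a) ^ 3" for a
  have E: "(E has_real_derivative 3 / (b - a) ^ 4) (at a)"
    using assms unfolding E_def[abs_def]
    by (auto intro!: derivative_eq_intros simp: divide_simps eval_nat_numeral) (simp_all add: algebra_simps)
  have "((\<lambda>a. fl a * (rho a - E a) + fl b * (rho b - E a)) has_real_derivative kcurve_a a b) (at a)"
    unfolding kcurve_a_def E_def[symmetric]
    by (rule derivative_eq_intros E chain_intros refl)+ (simp add: algebra_simps add_divide_distrib)
  then show ?thesis
    by (simp add: kcurve_def E_def)
qed

text \<open>\<open>fl b\<close> is negative once \<open>b\<close> exceeds \<open>sqrt 3\<close>, so
  the sign of \<open>fl a + fl b\<close> is not evident. Adding \<open>fl a * (D - rho b)\<close> to
  both sides of the first equation gives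
  \<open>(fl a + fl b) * (D - rho b) = fl a * (rho a - rho b)\<close>, where \<open>D\<close> is the
  inverse cube.\<close>

lemma kcurve_zero:
  assumes "0 < a" "a < sqrt 3" "a < b" "kcurve a b = 0"
  shows "fl a * (rho a - 1 / (b - a) ^ 3) = fl b * (1 / (b - a) ^ 3 - rho b)"
    and "0 < 1 / (b - a) ^ 3 - rho b" and "0 < fl a" and "0 < fl a + fl b"
proof -
  let ?D = "1 / (b - a) ^ 3"
  show eq: "fl a * (rho a - ?D) = fl b * (?D - rho b)"
    using assms(4) by (simp add: kcurve_def right_diff_distrib)
  show u: "0 < ?D - rho b"
    using rho_less_inverse_cube[of "b - a" b] assms by simp
  show fa: "0 < fl a"
    using fl_sign assms by simp
  have "(fl a + fl b) * (?D - rho b) = fl a * (rho a - rho b)"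
    using eq by (simp only: ring_distribs left_diff_distrib right_diff_distrib)
  moreover have "0 < fl a * (rho a - rho b)"
    using fa rho_less_iff[of a b] assms by simp
  ultimately show "0 < fl a + fl b"
    using u by (metis zero_less_mult_pos2)
qed

text \<open>Multiplied by d = b - a, every term is nonnegative for b \<ge> sqrt 3; for b < sqrt 3 the gam term is absorbed
  using b gam b < 3 rho b and D = rho b + u.\<close>

lemma kcurve_b_pos:
  assumes "0 < a" "a < sqrt 3" "a < b" "kcurve a b = 0"
  shows "0 < kcurve_b a b"
proof -
  define D where "D = 1 / (b - a) ^ 3"
  define d where "d = b - a"
  define u where "u = D - rho b"
  define B where "B = rho b - 1 / 8"
  have d: "0 < d" "d < b" "0 < b" and D: "0 < D"
    using assms by (auto simp: d_def D_def)
  note z = kcurve_zero[OF assms, folded D_def]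
  have "d * kcurve_b a b = 3 * D * (fl a + fl b) - d * fl' b * u - d * (fl b * gam b)"
    using d unfolding kcurve_b_def u_def D_def d_def[symmetric]
    by (simp add: field_simps eval_nat_numeral)
  also have "0 < \<dots>"
  proof (cases "sqrt 3 \<le> b")
    case True
    then have "B \<le> 0" "fl b \<le> 0"
      using fl_sign(1)[of b] rho_less_iff[of "b" "sqrt 3"] d by (auto simp: B_def rho_sqrt3 not_less)
    then have "fl' b \<le> 0"
      using mult_pos_pos[OF d(3) gam_pos[OF d(3)]] by (simp add: fl'_altdef B_def)
    then have "d * fl' b * u \<le> 0"
      using d z by (simp add: u_def mult_nonpos_nonneg mult_nonneg_nonpos)
    moreover have "d * (fl b * gam b) \<le> 0"
      using d gam_pos[of b] \<open>fl b \<le> 0\<close> by (simp add: mult_nonpos_nonneg mult_nonneg_nonpos less_imp_le)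
    moreover have "0 < 3 * D * (fl a + fl b)"
      using D z by simp
    ultimately show ?thesis by linarith
  next
    case False
    then have B: "0 < B"
      using rho_less_iff[of b "sqrt 3"] d by (auto simp: B_def rho_sqrt3)
    have S: "rho b > 0" "u > 0" "D = rho b + u"
      using z by (auto simp: u_def rho_pos)
    have bg: "b * gam b \<le> 3 * rho b"
      using S one_plus_sq_pos[of b] by (simp add: gam_altdef)
    have bg': "0 < b * gam b"
      using d gam_pos[of b] by simp
    \<comment> \<open>The multiple \<open>B - u\<close> arises because
      \<open>fl' b = B - b * gam b\<close> and \<open>fl b = b * B\<close>. Replacing
      \<open>d\<close> by \<open>b\<close> and \<open>b * gam b\<close> by \<open>3 * rho b\<close>
      enlarges the product only if \<open>B - u\<close> is nonnegative, hence the case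
      split.\<close>
    have "d * (b * gam b) * (B - u) \<le> b * (3 * rho b * B)"
    proof (cases "u \<le> B")
      case True
      have "d * ((b * gam b) * (B - u)) \<le> b * ((3 * rho b) * (B - u))"
        using d True bg bg' by (intro mult_mono[OF less_imp_le[OF d(2)] mult_right_mono] mult_nonneg_nonneg[OF less_imp_le]) simp_all
      also have "\<dots> \<le> b * (3 * rho b * B)"
        using d S by (intro mult_left_mono) auto
      finally show ?thesis by (simp add: mult.assoc)
    next
      case False
      then have "d * (b * gam b) * (B - u) \<le> 0"
        using d bg' by (intro mult_nonneg_nonpos) auto
      also have "0 \<le> b * (3 * rho b * B)"
        using d S B by simp
      finally show ?thesis .
    qed
    moreover have "d * (B * u) \<le> b * (B * u)"
      using d B S by (intro mult_right_mono) auto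
    moreover have "3 * D * (fl a + fl b) = 3 * D * fl a + b * (3 * rho b * B) + 3 * (b * (B * u))"
      using S by (simp add: fl_def B_def algebra_simps)
    moreover have "d * fl' b * u + d * (fl b * gam b) = d * (B * u) + d * (b * gam b) * (B - u)"
      by (simp add: fl_def fl'_altdef B_def algebra_simps)
    moreover have "0 < 3 * D * fl a" "0 < b * (B * u)"
      using D z B S d by auto
    ultimately show ?thesis by linarith
  qed
  finally show ?thesis
    using d by (simp add: zero_less_mult_iff)
qed

lemma kcurve_pos_after:
  assumes "0 < a" "a < sqrt 3" "a < b" "0 \<le> kcurve a b" "b < c"
  shows "0 < kcurve a c"
proof (rule pos_after_zero[where g = "kcurve a" and x = b and y = c])
  show "continuous_on {b..c} (kcurve a)"
    using assms by (intro continuous_at_imp_continuous_on ballI DERIV_isCont[OF has_derivative_kcurve_b]) auto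
  show "\<exists>D>0. (kcurve a has_real_derivative D) (at z)" if "b \<le> z" "z \<le> c" "kcurve a z = 0" for z
    using has_derivative_kcurve_b[of a z] kcurve_b_pos[of a z] that assms by auto
qed (use assms in auto)

text \<open>The inverse cube drives \<open>kcurve a\<close> to minus infinity as \<open>b\<close>
  decreases to \<open>a\<close>, and at \<open>b = a + 2\<close> the value is positive; uniqueness
  is \<open>kcurve_pos_after\<close>.\<close>

lemma kcurve_ex1:
  assumes "0 < a" "a < sqrt 3"
  shows "\<exists>!b. a < b \<and> kcurve a b = 0"
proof -
  have cont: "isCont (kcurve a) b" if "a < b" for b
    using has_derivative_kcurve_b[OF that] by (rule DERIV_isCont)
  \<comment> \<open>\<open>kcurve\<close> multiplied by \<open>(b - a) ^ 3\<close> extends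
    continuously to \<open>b = a\<close>, where its value is \<open>- 2 * fl a\<close>.\<close>
  have "isCont (\<lambda>b. (b - a) ^ 3 * (fl a * rho a + fl b * rho b) - (fl a + fl b)) a"
    by (intro continuous_intros DERIV_isCont[OF has_derivative_fl] DERIV_isCont[OF has_derivative_rho])
  moreover have "(a - a) ^ 3 * (fl a * rho a + fl a * rho a) - (fl a + fl a) < 0"
    using fl_sign(1)[of a] assms by simp
  ultimately have "\<forall>\<^sub>F b in at a. (b - a) ^ 3 * (fl a * rho a + fl b * rho b) - (fl a + fl b) < 0"
    unfolding isCont_def by (rule order_tendstoD)
  then have "\<forall>\<^sub>F b in at_right a. (b - a) ^ 3 * (fl a * rho a + fl b * rho b) - (fl a + fl b) < 0"
    by (simp add: eventually_at_split)
  then obtain e where "e > a" and e: "\<And>b. a < b \<Longrightarrow> b < e \<Longrightarrow>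
      (b - a) ^ 3 * (fl a * rho a + fl b * rho b) - (fl a + fl b) < 0"
    unfolding eventually_at_right_field by auto
  define b1 where "b1 = min ((a + e) / 2) (a + 1)"
  have b1: "a < b1" "b1 \<le> a + 1" "b1 < e"
    using \<open>e > a\<close> by (auto simp: b1_def min_def field_simps)
  have "(b1 - a) ^ 3 * kcurve a b1 = (b1 - a) ^ 3 * (fl a * rho a + fl b1 * rho b1) - (fl a + fl b1)"
    using b1 by (simp add: kcurve_def field_simps)
  also have "\<dots> < 0"
    using e b1 by blast
  finally have neg: "kcurve a b1 < 0"
    using b1 by (auto simp: mult_less_0_iff zero_less_power)
  have "rho (sqrt 3) < rho a"
    using rho_less_iff[of a "sqrt 3"] assms by simp
  \<comment> \<open>At \<open>b = a + 2\<close> the inverse cube is exactly 1/8, the value of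
    \<open>rho\<close> at \<open>sqrt 3\<close>. In each of the two products both factors then have
    the same sign.\<close>
  have "sqrt 3 < 2"
    by (rule real_less_lsqrt) auto
  then have "fl (a + 2) < 0"
    using fl_sign(2)[of "a + 2"] assms by simp
  moreover have "rho (a + 2) < 1 / 2 ^ 3"
    using rho_less_inverse_cube[of 2 "a + 2"] assms by simp
  ultimately have "0 < fl (a + 2) * (rho (a + 2) - 1 / 2 ^ 3)"
    by (intro mult_neg_neg) auto
  moreover have "0 < fl a * (rho a - 1 / 2 ^ 3)"
    using fl_sign(1)[of a] assms \<open>rho (sqrt 3) < rho a\<close> by (intro mult_pos_pos) (auto simp: rho_sqrt3)
  ultimately have "0 < kcurve a (a + 2)"
    by (simp add: kcurve_def)
  then obtain b where "b1 \<le> b" "b \<le> a + 2" "kcurve a b = 0"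
    using IVT'[of "kcurve a" b1 0 "a + 2"] neg b1 cont
    by (force intro!: continuous_at_imp_continuous_on)
  moreover have "b = c" if "a < b" "kcurve a b = 0" "a < c" "kcurve a c = 0" for b c
    using kcurve_pos_after[OF assms, of b c] kcurve_pos_after[OF assms, of c b] that
    by (cases b c rule: linorder_cases) auto
  ultimately show ?thesis
    using b1 by (intro ex_ex1I exI[of _ b]) auto
qed

section \<open>The solution curve\<close>

definition phi :: "real \<Rightarrow> real" where
  "phi a = (THE b. a < b \<and> kcurve a b = 0)"

lemma phi:
  assumes "0 < a" "a < sqrt 3" shows "a < phi a" "kcurve a (phi a) = 0"
  using theI'[OF kcurve_ex1[OF assms]] by (auto simp: phi_def)

lemma phi_eqI:
  assumes "0 < a" "a < sqrt 3" "a < b" "kcurve a b = 0" shows "b = phi a"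
  using kcurve_ex1[OF assms(1,2)] phi[OF assms(1,2)] assms(3,4) by blast

text \<open>One sign evaluation of \<open>kcurve\<close> puts \<open>phi a\<close> on one side of
  \<open>b\<close>. Both the continuity of \<open>phi\<close> and its numerical enclosures rest on
  this.\<close>

lemma phi_less_iff:
  assumes "0 < a" "a < sqrt 3" "a < b"
  shows "b < phi a \<longleftrightarrow> kcurve a b < 0" "phi a < b \<longleftrightarrow> 0 < kcurve a b"
proof -
  consider "b < phi a" | "b = phi a" | "phi a < b" by linarith
  then have "b < phi a \<and> kcurve a b < 0 \<or> b = phi a \<and> kcurve a b = 0 \<or> phi a < b \<and> 0 < kcurve a b"
  proof cases
    case 1
    then show ?thesis
      using kcurve_pos_after[OF assms, of "phi a"] phi[OF assms(1,2)] by (auto simp: not_less[symmetric])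
  next
    case 3
    then show ?thesis
      using kcurve_pos_after[OF assms(1,2), of "phi a" b] phi[OF assms(1,2)] by auto
  qed (use phi[OF assms(1,2)] in auto)
  then show "b < phi a \<longleftrightarrow> kcurve a b < 0" "phi a < b \<longleftrightarrow> 0 < kcurve a b"
    by auto
qed

text \<open>The sign of \<open>kcurve\<close> at a fixed second argument persists under small
  changes of the first one.\<close>

lemma isCont_phi:
  assumes "0 < a" "a < sqrt 3" shows "isCont phi a"
  unfolding isCont_def
proof (rule order_tendstoI)
  have dom: "\<forall>\<^sub>F x in at a. 0 < x" "\<forall>\<^sub>F x in at a. x < sqrt 3"
    using order_tendstoD[OF tendsto_ident_at] assms by auto
  have evlt: "\<forall>\<^sub>F x in at a. x < y" if "a < y" for y
    using order_tendstoD(2)[OF tendsto_ident_at that] .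
  have conta: "((\<lambda>x. kcurve x y) \<longlongrightarrow> kcurve a y) (at a)" if "a < y" for y
    using DERIV_isCont[OF has_derivative_kcurve_a[OF that]] by (simp add: isCont_def)
  fix l assume "l < phi a"
  \<comment> \<open>\<open>l\<close> may lie below \<open>a\<close>, where the sign of
    \<open>kcurve\<close> says nothing; \<open>y\<close> lies strictly between \<open>a\<close> and
    \<open>phi a\<close>.\<close>
  define y where "y = max l ((a + phi a) / 2)"
  have y: "l \<le> y" "a < y" "y < phi a"
    using \<open>l < phi a\<close> phi(1)[OF assms] by (auto simp: y_def less_max_iff_disj)
  have "\<forall>\<^sub>F x in at a. kcurve x y < 0"
    using order_tendstoD(2)[OF conta[OF y(2)]] phi_less_iff(1)[OF assms y(2)] y by auto
  with dom evlt[OF y(2)] show "\<forall>\<^sub>F x in at a. l < phi x"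
    by eventually_elim (use phi_less_iff(1) y(1) in force)
next
  have dom: "\<forall>\<^sub>F x in at a. 0 < x" "\<forall>\<^sub>F x in at a. x < sqrt 3"
    using order_tendstoD[OF tendsto_ident_at] assms by auto
  fix u assume u: "phi a < u"
  then have au: "a < u"
    using phi(1)[OF assms] by simp
  have "((\<lambda>x. kcurve x u) \<longlongrightarrow> kcurve a u) (at a)"
    using DERIV_isCont[OF has_derivative_kcurve_a[OF au]] by (simp add: isCont_def)
  then have "\<forall>\<^sub>F x in at a. 0 < kcurve x u"
    using order_tendstoD(1) phi_less_iff(2)[OF assms au] u by blast
  moreover have "\<forall>\<^sub>F x in at a. x < u"
    using order_tendstoD(2)[OF tendsto_ident_at au] .
  ultimately show "\<forall>\<^sub>F x in at a. phi x < u"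
    using dom by eventually_elim (use phi_less_iff(2) in force)
qed

lemma has_derivative_phi:
  assumes "0 < a" "a < sqrt 3"
  shows "(phi has_real_derivative (- kcurve_a a (phi a) / kcurve_b a (phi a))) (at a)"
proof (rule has_real_derivative_implicit)
  have "\<forall>\<^sub>F x in nhds a. x \<in> {0<..<sqrt 3}"
    using assms by (intro eventually_nhds_in_open) auto
  then show "\<forall>\<^sub>F x in nhds a. kcurve x (phi x) = 0"
    by eventually_elim (use phi in auto)
  have "((\<lambda>x. phi a - x) \<longlongrightarrow> phi a - a) (nhds a)"
    by (intro tendsto_intros filterlim_ident)
  then have "\<forall>\<^sub>F x in nhds a. 0 < phi a - x"
    by (rule order_tendstoD) (use phi assms in simp)
  with \<open>\<forall>\<^sub>F x in nhds a. x \<in> {0<..<sqrt 3}\<close>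
  show "\<forall>\<^sub>F x in nhds a. \<forall>y. min (phi a) (phi x) \<le> y \<longrightarrow> y \<le> max (phi a) (phi x) \<longrightarrow>
                 (kcurve x has_real_derivative kcurve_b x y) (at y)"
    by eventually_elim (auto intro!: has_derivative_kcurve_b dest: phi(1))
  have pa: "phi a - a \<noteq> 0"
    using phi(1)[OF assms] by simp
  show "isCont (\<lambda>(x, y). kcurve_b x y) (a, phi a)"
    unfolding kcurve_b_def case_prod_unfold using pa
    by (intro continuous_intros isCont_o2[OF _ DERIV_isCont[OF has_derivative_rho]] isCont_o2[OF _ DERIV_isCont[OF has_derivative_fl]]
       isCont_o2[OF _ DERIV_isCont[OF has_derivative_fl']] isCont_o2[OF _ DERIV_isCont[OF has_derivative_gam]]) auto
  show "((\<lambda>x. kcurve x (phi a)) has_real_derivative kcurve_a a (phi a)) (at a)"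
    using has_derivative_kcurve_a phi assms by auto
  show "kcurve_b a (phi a) \<noteq> 0"
    using kcurve_b_pos phi assms by (metis less_irrefl)
qed (use isCont_phi assms in auto)

section \<open>The mass ratio along the curve and its derivative\<close>

definition nu :: "real \<Rightarrow> real" where
  "nu a = (phi a - a) * (1 / (phi a - a) ^ 3 - rho (phi a)) / fl a"

text \<open>\<open>nu\<close> is defined by dividing by \<open>fl a\<close>, which is positive on
  the whole range, whereas \<open>fl (phi a)\<close> changes sign where \<open>phi a\<close> passes
  \<open>sqrt 3\<close>. The second kite equation is recovered through
  \<open>kcurve_zero\<close>.\<close>

lemma nu:
  assumes "0 < a" "a < sqrt 3"
  shows "nu a * fl a = (phi a - a) * (1 / (phi a - a) ^ 3 - rho (phi a))"
    and "nu a * fl (phi a) = (phi a - a) * (rho a - 1 / (phi a - a) ^ 3)"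
    and "0 < nu a"
proof -
  note p = phi[OF assms]
  note z = kcurve_zero[OF assms p]
  show 1: "nu a * fl a = (phi a - a) * (1 / (phi a - a) ^ 3 - rho (phi a))"
    using z by (simp add: nu_def)
  have "(nu a * fl (phi a)) * fl a = (nu a * fl a) * fl (phi a)"
    by simp
  also have "\<dots> = (phi a - a) * (fl a * (rho a - 1 / (phi a - a) ^ 3))"
    unfolding 1 z(1) by simp
  finally have "(nu a * fl (phi a)) * fl a = ((phi a - a) * (rho a - 1 / (phi a - a) ^ 3)) * fl a"
    by (simp only: mult_ac)
  then show "nu a * fl (phi a) = (phi a - a) * (rho a - 1 / (phi a - a) ^ 3)"
    using z(3) by simp
  show "0 < nu a"
    using z p unfolding nu_def by (intro divide_pos_pos mult_pos_pos) auto
qed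

text \<open>Differentiating nu a * fl a = d (D - rho b) and nu a * fl b = d (rho a - D) along b = phi a gives two linear
  equations for the derivatives of nu and phi; by Cramer's rule the derivative of nu is jac / jac_den.  The quotient slope_num / slope_den is the derivative of phi
  where that of nu vanishes.\<close>

definition slope_num :: "real \<Rightarrow> real \<Rightarrow> real \<Rightarrow> real" where
  "slope_num a b n = 2 / (b - a) ^ 3 + rho b - n * fl' a"

definition slope_den :: "real \<Rightarrow> real \<Rightarrow> real" where
  "slope_den a b = 2 / (b - a) ^ 3 + rho b - (b - a) * gam b"

definition jac :: "real \<Rightarrow> real \<Rightarrow> real \<Rightarrow> real" where
  "jac a b n = (2 / (b - a) ^ 3 + rho b - n * fl' a) * (2 / (b - a) ^ 3 + rho a - n * fl' b)
     - (2 / (b - a) ^ 3 + rho b - (b - a) * gam b) * (2 / (b - a) ^ 3 + rho a + (b - a) * gam a)"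

definition jac_den :: "real \<Rightarrow> real \<Rightarrow> real \<Rightarrow> real" where
  "jac_den a b n = fl a * (2 / (b - a) ^ 3 + rho a - n * fl' b)
     + fl b * (2 / (b - a) ^ 3 + rho b - (b - a) * gam b)"

text \<open>The inverse cube exceeds \<open>rho b\<close>, so the first two terms exceed
  \<open>3 * rho b\<close>, while \<open>(b - a) * gam b\<close> is at most
  \<open>b * gam b\<close>, which is less than \<open>3 * rho b\<close>.\<close>

lemma slope_den_pos:
  assumes "0 < a" "a < b" shows "0 < slope_den a b"
proof -
  have "(b - a) * gam b \<le> b * gam b"
    using assms gam_pos[of b] by (intro mult_right_mono) auto
  moreover have "rho b < 1 / (b - a) ^ 3"
    using assms by (intro rho_less_inverse_cube) auto
  moreover have "0 < 3 * rho b / (1 + b\<^sup>2)"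
    by (simp add: rho_pos one_plus_sq_pos)
  ultimately show ?thesis
    by (simp add: slope_den_def gam_altdef)
qed

text \<open>Up to sign this is the determinant of the linear system. On the curve it equals
  \<open>(phi a - a) * kcurve_b a (phi a)\<close>, so \<open>kcurve_b_pos\<close> applies.\<close>

lemma jac_den_pos:
  assumes "0 < a" "a < sqrt 3"
  shows "0 < jac_den a (phi a) (nu a)"
proof -
  note p = phi[OF assms]
  define d where "d = phi a - a"
  define D where "D = 1 / d ^ 3"
  have d: "0 < d" and D2: "2 / d ^ 3 = 2 * D"
    using p by (simp_all add: d_def D_def)
  note eq = nu(1,2)[OF assms, folded d_def, folded D_def]
  have sum: "fl a * rho a + fl (phi a) * rho (phi a) = D * (fl a + fl (phi a))"
    using p(2) by (simp add: kcurve_def d_def[symmetric] D_def[symmetric] algebra_simps)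
  have "jac_den a (phi a) (nu a) = 2 * D * (fl a + fl (phi a)) + (fl a * rho a + fl (phi a) * rho (phi a))
      - (nu a * fl a) * fl' (phi a) - d * (fl (phi a) * gam (phi a))"
    unfolding jac_den_def d_def[symmetric] D2 by (simp add: algebra_simps)
  also have "\<dots> = 3 * D * (fl a + fl (phi a)) + d * (fl' (phi a) * (rho (phi a) - D)) - d * (fl (phi a) * gam (phi a))"
    unfolding sum eq by (simp add: algebra_simps)
  also have "\<dots> = d * kcurve_b a (phi a)"
    using d unfolding kcurve_b_def d_def[symmetric] D_def
    by (simp add: field_simps eval_nat_numeral)
  also have "\<dots> > 0"
    using d kcurve_b_pos[OF assms p] by simp
  finally show ?thesis .
qed

context
  fixes a :: real
  assumes a: "0 < a" "a < sqrt 3"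
begin

lemma phi_differentiable: "(phi has_real_derivative deriv phi a) (at a)"
  using has_derivative_phi[OF a] DERIV_imp_deriv by metis

lemma has_derivative_inverse_cube:
  "((\<lambda>x. 1 / (phi x - x) ^ 3) has_real_derivative - 3 * (deriv phi a - 1) / (phi a - a) ^ 4) (at a)"
  using phi(1)[OF a]
  by (auto intro!: derivative_eq_intros phi_differentiable simp: divide_simps eval_nat_numeral)

lemma nu_differentiable: "(nu has_real_derivative deriv nu a) (at a)"
proof -
  have "fl a \<noteq> 0"
    using kcurve_zero(3)[OF a phi[OF a]] by simp
  then have "\<exists>D. (nu has_real_derivative D) (at a)"
    unfolding nu_def[abs_def]
    by (intro exI) (rule derivative_eq_intros has_derivative_inverse_cube phi_differentiable chain_intros refl | assumption)+
  then show ?thesis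
    using DERIV_imp_deriv by metis
qed

lemma deriv_nu_eqs:
  "deriv nu a * fl a = slope_num a (phi a) (nu a) - deriv phi a * slope_den a (phi a)"
  "deriv nu a * fl (phi a) = deriv phi a * (2 / (phi a - a) ^ 3 + rho a - nu a * fl' (phi a))
     - (2 / (phi a - a) ^ 3 + rho a + (phi a - a) * gam a)"
proof -
  let ?b = "phi a" and ?P = "deriv phi a"
  define d where "d = phi a - a"
  define E where "E x = 1 / (phi x - x) ^ 3" for x
  define E' where "E' = - 3 * (?P - 1) / d ^ 4"
  have d: "0 < d" and E2: "2 / d ^ 3 = 2 * E a"
    using phi(1)[OF a] by (simp_all add: d_def E_def)
  have E: "(E has_real_derivative E') (at a)"
    using has_derivative_inverse_cube by (simp add: E_def[abs_def] E'_def d_def)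
  \<comment> \<open>The factor \<open>d\<close> turns the derivative of the inverse cube back into a
    multiple of it. Combined with the \<open>E a\<close> of the product rule this yields the terms
    \<open>2 / (b - a) ^ 3\<close> of \<open>slope_num\<close>, \<open>slope_den\<close> and
    \<open>jac\<close>.\<close>
  have dE': "d * E' = - 3 * ?P * E a + 3 * E a"
    using d by (simp add: E'_def E_def d_def[symmetric] field_simps eval_nat_numeral)
  note intros = derivative_eq_intros E phi_differentiable nu_differentiable chain_intros refl
  have open_dom: "a \<in> {0<..<sqrt 3}" "open {0<..<sqrt 3}"
    using a by auto
  have lhs: "((\<lambda>x. nu x * fl x) has_real_derivative deriv nu a * fl a + nu a * fl' a) (at a)"
    by (rule intros)+ simp
  have "((\<lambda>x. (phi x - x) * (E x - rho (phi x))) has_real_derivative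
      (?P - 1) * (E a - rho ?b) + d * E' + d * gam ?b * ?P) (at a)"
    by (rule intros)+ (simp add: d_def algebra_simps)
  then have "((\<lambda>x. nu x * fl x) has_real_derivative
      (?P - 1) * (E a - rho ?b) + d * E' + d * gam ?b * ?P) (at a)"
    by (rule has_field_derivative_transform_within_open[OF _ open_dom(2,1)]) (simp add: nu(1) E_def)
  from DERIV_unique[OF lhs this, unfolded dE']
  show "deriv nu a * fl a = slope_num a (phi a) (nu a) - deriv phi a * slope_den a (phi a)"
    unfolding slope_num_def slope_den_def d_def[symmetric] E2 by (simp add: algebra_simps)
  have lhs: "((\<lambda>x. nu x * fl (phi x)) has_real_derivative deriv nu a * fl ?b + nu a * (fl' ?b * ?P)) (at a)"
    by (rule intros)+ simp
  have "((\<lambda>x. (phi x - x) * (rho x - E x)) has_real_derivative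
      (?P - 1) * (rho a - E a) - d * gam a - d * E') (at a)"
    by (rule intros)+ (simp add: d_def algebra_simps)
  then have "((\<lambda>x. nu x * fl (phi x)) has_real_derivative
      (?P - 1) * (rho a - E a) - d * gam a - d * E') (at a)"
    by (rule has_field_derivative_transform_within_open[OF _ open_dom(2,1)]) (simp add: nu(2) E_def)
  from DERIV_unique[OF lhs this, unfolded dE']
  show "deriv nu a * fl (phi a) = deriv phi a * (2 / (phi a - a) ^ 3 + rho a - nu a * fl' (phi a))
     - (2 / (phi a - a) ^ 3 + rho a + (phi a - a) * gam a)"
    unfolding d_def[symmetric] E2 by (simp add: algebra_simps)
qed

lemma deriv_nu: "deriv nu a * jac_den a (phi a) (nu a) = jac a (phi a) (nu a)"
proof -
  have "deriv nu a * jac_den a (phi a) (nu a) =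
     (deriv nu a * fl a) * (2 / (phi a - a) ^ 3 + rho a - nu a * fl' (phi a)) +
     (deriv nu a * fl (phi a)) * slope_den a (phi a)"
    by (simp only: jac_den_def slope_den_def ring_distribs mult_ac)
  also have "\<dots> = jac a (phi a) (nu a)"
    unfolding deriv_nu_eqs jac_def slope_num_def slope_den_def by (simp only: ring_distribs) (simp only: mult_ac)
  finally show ?thesis .
qed

lemma has_derivative_nu:
  "(nu has_real_derivative jac a (phi a) (nu a) / jac_den a (phi a) (nu a)) (at a)"
  using nu_differentiable deriv_nu jac_den_pos[OF a] by (metis less_irrefl nonzero_eq_divide_eq)

end

text \<open>The derivative of jac along the curve at a point where the derivative of nu is zero; P is the derivative of phi there.\<close>

definition jac' :: "real \<Rightarrow> real \<Rightarrow> real \<Rightarrow> real \<Rightarrow> real" where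
  "jac' a b n P = (let d = b - a; D = 1 / d ^ 3; w = P - 1;
      p = - (n * fl' a); q = - (n * fl' b); e = d * gam b; g = d * gam a;
      p' = - (n * fl'' a); q' = - (n * fl'' b * P);
      e' = w * gam b + d * gam' b * P; g' = w * gam a + d * gam' a
    in - (6 * D * w / d) * ((p + e) + (q - g)) + 2 * D * ((p' + e') + (q' - g'))
       + ((p' + e') * rho a - (p + e) * gam a) + ((q' - g') * rho b - (q - g) * gam b * P)
       + (p' * q + p * q') + (e' * g + e * g'))"

text \<open>At a zero of \<open>jac\<close> the derivative of \<open>nu\<close> vanishes, so
  \<open>nu\<close> differentiates like a constant and the first linear equation alone determines
  the derivative of \<open>phi\<close>.\<close>

lemma has_derivative_jac:
  assumes "0 < a" "a < sqrt 3" "jac a (phi a) (nu a) = 0"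
  shows "((\<lambda>x. jac x (phi x) (nu x)) has_real_derivative
    jac' a (phi a) (nu a) (slope_num a (phi a) (nu a) / slope_den a (phi a))) (at a)"
proof -
  let ?b = "phi a" and ?P = "deriv phi a" and ?n = "nu a"
  define d where "d = ?b - a"
  define P where "P = slope_num a (phi a) (nu a) / slope_den a (phi a)"
  have d: "0 < d"
    using phi(1)[OF assms(1,2)] by (simp add: d_def)
  have nu0: "(nu has_real_derivative 0) (at a)"
    using has_derivative_nu[OF assms(1,2)] assms(3) by simp
  have "deriv phi a = P"
    using deriv_nu_eqs(1)[OF assms(1,2)] DERIV_imp_deriv[OF nu0] slope_den_pos[OF assms(1) phi(1)[OF assms(1,2)]]
    by (simp add: P_def field_simps)
  then have phi': "(phi has_real_derivative P) (at a)"
    using phi_differentiable[OF assms(1,2)] by simp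
  define E where "E x = 1 / (phi x - x) ^ 3" for x
  define K where "K = 6 * E a * (P - 1) / d"
  define E' where "E' = - K / 2"
  have "E' = - 3 * (P - 1) / d ^ 4"
    using d by (simp add: E'_def K_def E_def d_def[symmetric] field_simps eval_nat_numeral)
  then have E: "(E has_real_derivative E') (at a)"
    using has_derivative_inverse_cube[OF assms(1,2)] \<open>deriv phi a = P\<close>
    by (simp add: E_def[abs_def] d_def)
  have jac_eq: "jac x (phi x) (nu x) = (2 * E x + rho (phi x) - nu x * fl' x) * (2 * E x + rho x - nu x * fl' (phi x))
     - (2 * E x + rho (phi x) - (phi x - x) * gam (phi x)) * (2 * E x + rho x + (phi x - x) * gam x)" for x
    by (simp add: jac_def E_def)
  have Ea: "1 / d ^ 3 = E a"
    by (simp add: E_def d_def)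
  \<comment> \<open>\<open>jac'\<close> is written with the products common to both halves of the
    determinant already cancelled, for the sake of its interval evaluation; here it is matched with
    the product rule.\<close>
  have eq: "jac' a ?b ?n P =
      (2 * E' - gam ?b * P - ?n * fl'' a) * (2 * E a + rho a - ?n * fl' ?b)
    + (2 * E a + rho ?b - ?n * fl' a) * (2 * E' - gam a - ?n * fl'' ?b * P)
    - (2 * E' - gam ?b * P - ((P - 1) * gam ?b + d * gam' ?b * P)) * (2 * E a + rho a + d * gam a)
    - (2 * E a + rho ?b - d * gam ?b) * (2 * E' - gam a + ((P - 1) * gam a + d * gam' a))"
    unfolding jac'_def Let_def d_def[symmetric] Ea K_def[symmetric] E'_def
    by (simp add: algebra_simps)
  show ?thesis
    unfolding P_def[symmetric] eq jac_eq[abs_def] d_def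
    by (rule derivative_eq_intros E phi' nu0 chain_intros refl)+ (simp add: algebra_simps)
qed

section \<open>Interval arithmetic on scaled integers\<close>

type_synonym iv = "int \<times> int"

text \<open>An interval (l, u) stands for the real interval from l / S to u / S.  All operations round outwards
  to integers, so that the checks below can be evaluated by rewriting.\<close>

definition encl :: "int \<Rightarrow> iv \<Rightarrow> real \<Rightarrow> bool" where
  "encl S I x \<longleftrightarrow> of_int (fst I) \<le> of_int S * x \<and> of_int S * x \<le> of_int (snd I)"

definition iadd :: "iv \<Rightarrow> iv \<Rightarrow> iv" where
  "iadd I J = (fst I + fst J, snd I + snd J)"

definition isub :: "iv \<Rightarrow> iv \<Rightarrow> iv" where
  "isub I J = (fst I - snd J, snd I - fst J)"

definition ineg :: "iv \<Rightarrow> iv" where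
  "ineg I = (- snd I, - fst I)"

definition iscale :: "int \<Rightarrow> iv \<Rightarrow> iv" where
  "iscale k I = (k * fst I, k * snd I)"

definition ihull :: "iv \<Rightarrow> iv \<Rightarrow> iv" where
  "ihull I J = (min (fst I) (fst J), max (snd I) (snd J))"

definition iinter :: "iv \<Rightarrow> iv \<Rightarrow> iv" where
  "iinter I J = (max (fst I) (fst J), min (snd I) (snd J))"

text \<open>\<open>div\<close> rounds down for positive \<open>k\<close>; negating before and after
  makes the upper end round up.\<close>

definition iround :: "int \<Rightarrow> iv \<Rightarrow> iv" where
  "iround k I = (fst I div k, - ((- snd I) div k))"

definition imul :: "int \<Rightarrow> iv \<Rightarrow> iv \<Rightarrow> iv" where
  "imul S I J = iround S
     (ihull (min (fst I * fst J) (fst I * snd J), max (fst I * fst J) (fst I * snd J))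
        (min (snd I * fst J) (snd I * snd J), max (snd I * fst J) (snd I * snd J)))"

text \<open>Meant for positive divisors \<open>J\<close>: the sign of each end of \<open>I\<close>
  decides which end of \<open>J\<close> gives the extreme quotient.\<close>

definition idiv :: "int \<Rightarrow> iv \<Rightarrow> iv \<Rightarrow> iv" where
  "idiv S I J = (fst I * S div (if 0 \<le> fst I then snd J else fst J),
     - ((- snd I * S) div (if 0 \<le> snd I then fst J else snd J)))"

text \<open>The scaled value \<open>S / d ^ 3\<close> equals \<open>S ^ 4 / (S * d) ^ 3\<close>, and
  it decreases in \<open>d\<close>, so the upper end \<open>d1\<close> supplies the lower
  bound.\<close>

definition icube :: "int \<Rightarrow> int \<Rightarrow> int \<Rightarrow> iv" where
  "icube S d0 d1 = (S ^ 4 div d1 ^ 3, - ((- (S ^ 4)) div d0 ^ 3))"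

lemma real_div_le: "0 < k \<Longrightarrow> of_int (m div k) * of_int k \<le> (of_int m :: real)" for m k :: int
  using div_mult_mod_eq[of m k] pos_mod_sign[of k m]
  by (metis add.commute le_add_same_cancel1 of_int_le_iff of_int_mult)

lemma div_le: "0 < k \<Longrightarrow> of_int (m div k) \<le> (of_int m / of_int k :: real)" for m k :: int
  using real_div_le[of k m] by (simp add: field_simps)

lemma le_neg_div: "0 < k \<Longrightarrow> (of_int m / of_int k :: real) \<le> of_int (- ((- m) div k))" for m k :: int
  using div_le[of k "- m"] by simp

lemma mult_between:
  fixes x y :: real
  assumes "l \<le> x" "x \<le> u" "l' \<le> y" "y \<le> u'"
  shows "min (min (l * l') (l * u')) (min (u * l') (u * u')) \<le> x * y"
    and "x * y \<le> max (max (l * l') (l * u')) (max (u * l') (u * u'))"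
proof -
  have 1: "min (c * l') (c * u') \<le> c * y \<and> c * y \<le> max (c * l') (c * u')" for c
    using assms(3,4) by (cases "0 \<le> c") (auto simp: min_le_iff_disj le_max_iff_disj mult_left_mono mult_left_mono_neg)
  have 2: "min (l * y) (u * y) \<le> x * y \<and> x * y \<le> max (l * y) (u * y)"
    using assms(1,2) by (cases "0 \<le> y") (auto simp: min_le_iff_disj le_max_iff_disj mult_right_mono mult_right_mono_neg)
  show "min (min (l * l') (l * u')) (min (u * l') (u * u')) \<le> x * y"
    and "x * y \<le> max (max (l * l') (l * u')) (max (u * l') (u * u'))"
    using 1[of l] 1[of u] 2 by linarith+
qed

context
  fixes S :: int
  assumes S: "0 < S"
begin

lemma S': "0 < (of_int S :: real)"
  using S by simp

lemma encl_add: "encl S I x \<Longrightarrow> encl S J y \<Longrightarrow> encl S (iadd I J) (x + y)"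
  by (auto simp: encl_def iadd_def distrib_left)

lemma encl_sub: "encl S I x \<Longrightarrow> encl S J y \<Longrightarrow> encl S (isub I J) (x - y)"
  by (auto simp: encl_def isub_def right_diff_distrib)

lemma encl_neg: "encl S I x \<Longrightarrow> encl S (ineg I) (- x)"
  by (auto simp: encl_def ineg_def)

lemma encl_scale: "0 \<le> k \<Longrightarrow> encl S I x \<Longrightarrow> encl S (iscale k I) (of_int k * x)"
  using mult_left_mono[of "of_int (fst I)" "of_int S * x" "of_int k"]
    mult_left_mono[of "of_int S * x" "of_int (snd I)" "of_int k"]
  by (simp add: encl_def iscale_def mult.left_commute)

lemma encl_inter: "encl S I x \<Longrightarrow> encl S J x \<Longrightarrow> encl S (iinter I J) x"
  by (auto simp: encl_def iinter_def min_def max_def)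

text \<open>Serves functions monotone on a segment: \<open>x\<close> and \<open>y\<close> are the
  values at its two ends.\<close>

lemma encl_hull:
  assumes "encl S I x" "encl S J y" "min x y \<le> z" "z \<le> max x y"
  shows "encl S (ihull I J) z"
proof -
  have "of_int S * x \<le> of_int S * z \<or> of_int S * y \<le> of_int S * z"
       "of_int S * z \<le> of_int S * x \<or> of_int S * z \<le> of_int S * y"
    using assms(3,4) S' by (auto simp: min_def max_def split: if_splits)
  then show ?thesis
    using assms(1,2) by (auto simp: encl_def ihull_def min_def max_def)
qed

lemma encl_mul:
  assumes "encl S I x" "encl S J y" shows "encl S (imul S I J) (x * y)"
proof -
  have *: "of_int l \<le> real_of_int S * ((of_int S * x) * y)" "real_of_int S * ((of_int S * x) * y) \<le> of_int u"
    if "iround S (l, u) = imul S I J"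
      "(l, u) = (ihull (min (fst I * fst J) (fst I * snd J), max (fst I * fst J) (fst I * snd J))
        (min (snd I * fst J) (snd I * snd J), max (snd I * fst J) (snd I * snd J)))" for l u
    using mult_between[of "of_int (fst I)" "of_int S * x" "of_int (snd I)" "of_int (fst J)" "of_int S * y" "of_int (snd J)"]
      assms that(2) by (simp_all add: encl_def ihull_def of_int_min of_int_max mult_ac)
  obtain l u where lu: "(l, u) = (ihull (min (fst I * fst J) (fst I * snd J), max (fst I * fst J) (fst I * snd J))
        (min (snd I * fst J) (snd I * snd J), max (snd I * fst J) (snd I * snd J)))"
    by (metis surj_pair)
  then have r: "iround S (l, u) = imul S I J"
    by (simp add: imul_def)
  have "of_int l / of_int S \<le> of_int S * (x * y)" "of_int S * (x * y) \<le> of_int u / of_int S"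
    using *[OF r lu] S' by (auto simp: field_simps)
  then show ?thesis
    using div_le[OF S, of l] le_neg_div[OF S, of u] unfolding r[symmetric] encl_def iround_def by auto
qed

lemma encl_div:
  assumes I: "encl S I x" and J: "encl S J y" and pos: "0 < fst J"
  shows "encl S (idiv S I J) (x / y)"
proof -
  let ?X = "of_int S * x" and ?Y = "of_int S * y"
  have Y: "0 < (of_int (fst J) :: real)" "of_int (fst J) \<le> ?Y" "?Y \<le> of_int (snd J)"
    using J pos by (auto simp: encl_def intro: less_le_trans[of 0 "of_int (fst J)"])
  then have "0 < ?Y"
    by linarith
  then have y: "0 < y"
    using S' by (simp add: zero_less_mult_iff)
  from Y have pos2: "0 < snd J"
    by (metis of_int_0_less_iff order_less_le_trans)
  have X: "of_int (fst I) \<le> ?X" "?X \<le> of_int (snd I)"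
    using I by (auto simp: encl_def)
  have eq: "of_int S * (x / y) = ?X * of_int S / ?Y"
    using S' by simp
  have "of_int (fst I) * of_int S / of_int (if 0 \<le> fst I then snd J else fst J) \<le> of_int (fst I) * of_int S / ?Y"
  proof (cases "0 \<le> fst I")
    case True
    then show ?thesis
      using Y S' y pos2 unfolding if_P[OF True] by (intro divide_left_mono mult_pos_pos mult_nonneg_nonneg) auto
  next
    case False
    then show ?thesis
      using Y S' y unfolding if_not_P[OF False] by (intro divide_left_mono_neg mult_pos_pos mult_nonpos_nonneg) auto
  qed
  also have "\<dots> \<le> ?X * of_int S / ?Y"
    using X Y S' y by (intro divide_right_mono mult_right_mono) auto
  finally have 1: "of_int (fst (idiv S I J)) \<le> of_int S * (x / y)"
    unfolding eq idiv_def fst_conv using pos pos2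
    by (intro order.trans[OF div_le]) auto
  have "?X * of_int S / ?Y \<le> of_int (snd I) * of_int S / ?Y"
    using X Y S' y by (intro divide_right_mono mult_right_mono) auto
  also have "\<dots> \<le> of_int (snd I) * of_int S / of_int (if 0 \<le> snd I then fst J else snd J)"
  proof (cases "0 \<le> snd I")
    case True
    then show ?thesis
      using Y S' y unfolding if_P[OF True] by (intro divide_left_mono mult_pos_pos mult_nonneg_nonneg) auto
  next
    case False
    then show ?thesis
      using Y S' y pos2 unfolding if_not_P[OF False] by (intro divide_left_mono_neg mult_pos_pos mult_nonpos_nonneg) auto
  qed
  finally have "of_int S * (x / y) \<le> of_int (snd I * S) / of_int (if 0 \<le> snd I then fst J else snd J)"
    unfolding eq by simp
  also have "\<dots> \<le> of_int (snd (idiv S I J))"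
    using le_neg_div[of "if 0 \<le> snd I then fst J else snd J" "snd I * S"] pos pos2
    by (simp add: idiv_def)
  finally have 2: "of_int S * (x / y) \<le> of_int (snd (idiv S I J))" .
  show ?thesis
    using 1 2 by (simp add: encl_def)
qed

lemma encl_one: "encl S (S, S) 1"
  by (simp add: encl_def)

lemma encl_eighth: "encl S (iround 8 (S, S)) (1 / 8)"
  using div_le[of 8 S] le_neg_div[of 8 S] by (simp add: encl_def iround_def)

lemma encl_point: "encl S (k, k) (of_int k / of_int S)"
  using S' by (simp add: encl_def)

lemma encl_cube:
  assumes "encl S (d0, d1) d" "0 < d0" shows "encl S (icube S d0 d1) (1 / d ^ 3)"
proof -
  have d: "of_int d0 \<le> of_int S * d" "of_int S * d \<le> of_int d1" "0 < (of_int d0 :: real)"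
    using assms by (auto simp: encl_def)
  then have "0 < of_int S * d" by linarith
  then have "0 < d"
    using S' by (simp add: zero_less_mult_iff)
  have d1: "0 < d1"
    using d \<open>0 < of_int S * d\<close> by linarith
  have eq: "of_int S * (1 / d ^ 3) = of_int (S ^ 4) / (of_int S * d) ^ 3"
    using S' \<open>0 < d\<close> by (simp add: field_simps eval_nat_numeral)
  have "of_int (S ^ 4) / of_int (d1 ^ 3) \<le> of_int S * (1 / d ^ 3)"
    unfolding eq of_int_power
    using d S' \<open>0 < of_int S * d\<close> d1 by (intro divide_left_mono power_mono) (auto simp: mult_pos_pos zero_less_power)
  moreover have "of_int S * (1 / d ^ 3) \<le> of_int (S ^ 4) / of_int (d0 ^ 3)"
    unfolding eq of_int_power
    using d S' \<open>0 < of_int S * d\<close> d1 by (intro divide_left_mono power_mono) (auto simp: mult_pos_pos zero_less_power)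
  moreover have "0 < d1 ^ 3" "0 < d0 ^ 3"
    using d1 assms by auto
  ultimately show ?thesis
    using div_le[of "d1 ^ 3" "S ^ 4"] le_neg_div[of "d0 ^ 3" "S ^ 4"] unfolding encl_def icube_def fst_conv snd_conv
    by (auto intro: order.trans)
qed

end

section \<open>Monotonicity ranges of the basic functions\<close>

lemma nondecreasing_if_deriv_nonneg:
  fixes F :: "real \<Rightarrow> real"
  assumes "\<And>x. (F has_real_derivative F' x) (at x)" and "\<And>x. p \<le> x \<Longrightarrow> x \<le> q \<Longrightarrow> 0 \<le> F' x" and "p \<le> q"
  shows "F p \<le> F q"
  using assms by (intro DERIV_nonneg_imp_nondecreasing[of p q F]) auto

lemma nonincreasing_if_deriv_nonpos:
  fixes F :: "real \<Rightarrow> real"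
  assumes "\<And>x. (F has_real_derivative F' x) (at x)" and "\<And>x. p \<le> x \<Longrightarrow> x \<le> q \<Longrightarrow> F' x \<le> 0" and "p \<le> q"
  shows "F q \<le> F p"
  using assms by (intro DERIV_nonpos_imp_nonincreasing[of p q F]) auto

lemma between_if_monotone:
  fixes F :: "real \<Rightarrow> real"
  assumes "\<And>x. (F has_real_derivative F' x) (at x)"
    and "(\<forall>x. p \<le> x \<and> x \<le> q \<longrightarrow> 0 \<le> F' x) \<or> (\<forall>x. p \<le> x \<and> x \<le> q \<longrightarrow> F' x \<le> 0)"
    and "p \<le> x" "x \<le> q"
  shows "min (F p) (F q) \<le> F x" "F x \<le> max (F p) (F q)"
proof -
  have "F p \<le> F x \<and> F x \<le> F q \<or> F q \<le> F x \<and> F x \<le> F p"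
    using assms(2)
  proof
    assume *: "\<forall>x. p \<le> x \<and> x \<le> q \<longrightarrow> 0 \<le> F' x"
    have "F p \<le> F x" "F x \<le> F q"
      by (rule nondecreasing_if_deriv_nonneg[OF assms(1)]; use * assms in auto)+
    then show ?thesis by simp
  next
    assume *: "\<forall>x. p \<le> x \<and> x \<le> q \<longrightarrow> F' x \<le> 0"
    have "F x \<le> F p" "F q \<le> F x"
      by (rule nonincreasing_if_deriv_nonpos[OF assms(1)]; use * assms in auto)+
    then show ?thesis by simp
  qed
  then show "min (F p) (F q) \<le> F x" "F x \<le> max (F p) (F q)"
    by auto
qed

lemma rho_le_iff: "0 \<le> x \<Longrightarrow> 0 \<le> y \<Longrightarrow> rho y \<le> rho x \<longleftrightarrow> x \<le> y"
  using rho_less_iff[of y x] by (simp add: not_less[symmetric])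

text \<open>\<open>fl\<close> has its maximum between 3/5 and 61/100. This lemma and the next give
  monotonicity on either side of that gap; 63/100 separates the values of \<open>rho\<close> at its
  two ends.\<close>

lemma fl'_pos:
  assumes "0 \<le> x" "x \<le> 3 / 5" shows "0 < fl' x"
proof -
  have "63 / 100 \<le> rho (3 / 5)"
    by (rule le_rho) (simp add: power_divide)
  then have r: "63 / 100 \<le> rho x"
    using rho_le_iff[of x "3 / 5"] assms by linarith
  have "x\<^sup>2 \<le> (3 / 5)\<^sup>2"
    using assms by (intro power_mono) auto
  then have x2: "x\<^sup>2 \<le> 9 / 25"
    by (simp add: power_divide)
  have "63 / 100 * (1 - 2 * x\<^sup>2) \<le> rho x * (1 - 2 * x\<^sup>2)"
    using r x2 by (intro mult_right_mono) auto
  then have "1 + x\<^sup>2 < 8 * (rho x * (1 - 2 * x\<^sup>2))"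
    using x2 by argo
  then show ?thesis
    using one_plus_sq_pos[of x] by (simp add: fl'_def field_simps)
qed

lemma fl'_neg:
  assumes "61 / 100 \<le> x" shows "fl' x < 0"
proof (cases "1 \<le> 2 * x\<^sup>2")
  case True
  then have "rho x * (1 - 2 * x\<^sup>2) / (1 + x\<^sup>2) \<le> 0"
    using rho_pos[of x] one_plus_sq_pos[of x] by (intro divide_nonpos_pos mult_nonneg_nonpos) auto
  then show ?thesis
    unfolding fl'_def by linarith
next
  case False
  have "rho (61 / 100) \<le> 63 / 100"
    by (rule rho_le) (simp_all add: power_divide)
  then have r: "rho x \<le> 63 / 100"
    using rho_le_iff[of "61 / 100" x] assms by linarith
  have "(61 / 100)\<^sup>2 \<le> x\<^sup>2"
    using assms by (intro power_mono) auto
  then have x2: "3721 / 10000 \<le> x\<^sup>2"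
    by (simp add: power_divide)
  have "rho x * (1 - 2 * x\<^sup>2) \<le> 63 / 100 * (1 - 2 * x\<^sup>2)"
    using r False by (intro mult_right_mono) auto
  then have "8 * (rho x * (1 - 2 * x\<^sup>2)) < 1 + x\<^sup>2"
    using x2 by argo
  then show ?thesis
    using one_plus_sq_pos[of x] by (simp add: fl'_def field_simps)
qed

lemma fl_mono: "0 \<le> x \<Longrightarrow> x \<le> y \<Longrightarrow> y \<le> 3 / 5 \<Longrightarrow> fl x \<le> fl y"
  by (rule nondecreasing_if_deriv_nonneg[OF has_derivative_fl]) (auto intro!: less_imp_le[OF fl'_pos])

lemma fl_antimono: "61 / 100 \<le> x \<Longrightarrow> x \<le> y \<Longrightarrow> fl y \<le> fl x"
  by (rule nonincreasing_if_deriv_nonpos[OF has_derivative_fl]) (auto intro!: less_imp_le[OF fl'_neg])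

text \<open>The sign changes at \<open>sqrt (3 / 2)\<close>, about 1.2247, which 61/50 and 123/100
  enclose; the integer tests in \<open>box_ok\<close> use the same two rationals.\<close>

lemma fl''_nonpos:
  assumes "0 \<le> x" "x \<le> 61 / 50" shows "fl'' x \<le> 0"
proof -
  have "2 * x\<^sup>2 - 3 \<le> 0"
    using power_mono[of x "61 / 50" 2] assms by (simp add: power_divide)
  then show ?thesis
    using assms rho_pos[of x] one_plus_sq_pos[of x] unfolding fl''_def
    by (intro divide_nonpos_pos mult_nonpos_nonneg mult_nonneg_nonpos) auto
qed

lemma fl''_nonneg: "123 / 100 \<le> x \<Longrightarrow> 0 \<le> fl'' x"
  using power_mono[of "123 / 100" x 2] rho_pos[of x] one_plus_sq_pos[of x]
  by (auto simp: fl''_def power_divide)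

lemma gam'_nonneg: "0 \<le> x \<Longrightarrow> x \<le> 1 / 2 \<Longrightarrow> 0 \<le> gam' x"
  using power_mono[of x "1 / 2" 2] rho_pos[of x] one_plus_sq_pos[of x]
  by (auto simp: gam'_def power_divide)

lemma gam'_nonpos: "1 / 2 \<le> x \<Longrightarrow> gam' x \<le> 0"
  using power_mono[of "1 / 2" x 2] rho_pos[of x] one_plus_sq_pos[of x]
  by (auto simp: gam'_def power_divide intro!: divide_nonpos_pos mult_nonpos_nonneg)

text \<open>Supplies the upper end of an enclosure when the segment may contain the maximum. Inside
  the gap the two factors of \<open>fl\<close> are bounded separately; outside it monotonicity leads
  back to the gap.\<close>

lemma fl_le:
  assumes "0 \<le> x" shows "fl x \<le> 31 / 100"
proof -
  have *: "rho (3 / 5) \<le> 631 / 1000"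
    by (rule rho_le) (simp_all add: power_divide)
  have mid: "fl x \<le> 31 / 100" if x: "3 / 5 \<le> x" "x \<le> 61 / 100" for x
  proof -
    have "rho x \<le> 631 / 1000"
      using * rho_le_iff[of "3 / 5" x] x by linarith
    then have "x * (rho x - 1 / 8) \<le> 61 / 100 * (631 / 1000 - 1 / 8)"
      using x rho_le_iff[of x "sqrt 3"] real_le_rsqrt[of x 3] power_mono[of x 1 2]
      by (intro mult_mono) (auto simp: rho_sqrt3)
    then show ?thesis
      by (simp add: fl_def)
  qed
  show ?thesis
    using fl_mono[of x "3 / 5"] fl_antimono[of "61 / 100" x] mid[of x] mid[of "3 / 5"] mid[of "61 / 100"] assms
    by linarith
qed

text \<open>\<open>fl\<close> is unimodal: if the slope at \<open>x\<close> is nonnegative then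
  \<open>x\<close> lies in the concave range, so the slope was nonnegative all the way from
  \<open>p\<close>; otherwise it stays nonpositive up to \<open>q\<close>.\<close>

lemma fl_ge_min:
  assumes "0 \<le> p" "p \<le> x" "x \<le> q" shows "min (fl p) (fl q) \<le> fl x"
proof (cases "0 \<le> fl' x")
  case True
  have "fl p \<le> fl x"
  proof (rule nondecreasing_if_deriv_nonneg[OF has_derivative_fl])
    fix y assume y: "p \<le> y" "y \<le> x"
    have "x \<le> 61 / 100"
      using True fl'_neg[of x] by linarith
    then have "fl' x \<le> fl' y"
      using y assms by (intro nonincreasing_if_deriv_nonpos[OF has_derivative_fl'] fl''_nonpos) auto
    then show "0 \<le> fl' y"
      using True by simp
  qed (use assms in auto)
  then show ?thesis by simp
next
  case False
  have "fl q \<le> fl x"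
  proof (rule nonincreasing_if_deriv_nonpos[OF has_derivative_fl])
    fix y assume y: "x \<le> y" "y \<le> q"
    show "fl' y \<le> 0"
    proof (cases "y \<le> 61 / 100")
      case True
      then have "fl' y \<le> fl' x"
        using y assms by (intro nonincreasing_if_deriv_nonpos[OF has_derivative_fl'] fl''_nonpos) auto
      then show ?thesis
        using False by simp
    qed (use fl'_neg[of y] in auto)
  qed (use assms in auto)
  then show ?thesis by simp
qed

text \<open>A sample point is a pair (x, r) standing for the argument x / S together with the
  enclosure of rho (x / S) by r / S and (r + 1) / S.\<close>

definition sample :: "int \<Rightarrow> iv \<Rightarrow> bool" where
  "sample S P \<longleftrightarrow> 0 \<le> fst P \<and> 0 \<le> snd P \<and>
     (snd P)\<^sup>2 * (S\<^sup>2 + (fst P)\<^sup>2) ^ 3 \<le> S ^ 8 \<and> S ^ 8 \<le> (snd P + 1)\<^sup>2 * (S\<^sup>2 + (fst P)\<^sup>2) ^ 3"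

definition segment :: "int \<Rightarrow> iv \<Rightarrow> iv \<Rightarrow> bool" where
  "segment S P Q \<longleftrightarrow> sample S P \<and> sample S Q \<and> fst P \<le> fst Q"

definition arg :: "int \<Rightarrow> iv \<Rightarrow> real" where
  "arg S P = of_int (fst P) / of_int S"

definition rho_pt :: "iv \<Rightarrow> iv" where
  "rho_pt P = (snd P, snd P + 1)"

definition sq_pt :: "int \<Rightarrow> iv \<Rightarrow> iv" where
  "sq_pt S P = imul S (fst P, fst P) (fst P, fst P)"

definition fl_pt :: "int \<Rightarrow> iv \<Rightarrow> iv" where
  "fl_pt S P = imul S (fst P, fst P) (isub (rho_pt P) (iround 8 (S, S)))"

definition fl'_pt :: "int \<Rightarrow> iv \<Rightarrow> iv" where
  "fl'_pt S P = isub (idiv S (imul S (rho_pt P) (isub (S, S) (iscale 2 (sq_pt S P)))) (iadd (S, S) (sq_pt S P)))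
     (iround 8 (S, S))"

definition gam_pt :: "int \<Rightarrow> iv \<Rightarrow> iv" where
  "gam_pt S P = idiv S (iscale 3 (imul S (fst P, fst P) (rho_pt P))) (iadd (S, S) (sq_pt S P))"

text \<open>\<open>rho\<close> decreases, so the lower end comes from the right sample
  \<open>Q\<close>; the \<open>+ 1\<close> is the rounding slack of the left one.\<close>

definition rho_iv :: "iv \<Rightarrow> iv \<Rightarrow> iv" where
  "rho_iv P Q = (snd Q, snd P + 1)"

text \<open>On either side of the gap from 3/5 to 61/100 the values at the ends suffice. Otherwise
  they still give the lower end, and the upper end is 31/100, rounded up.\<close>

definition fl_iv :: "int \<Rightarrow> iv \<Rightarrow> iv \<Rightarrow> iv" where
  "fl_iv S P Q = (if 5 * fst Q \<le> 3 * S \<or> 61 * S \<le> 100 * fst P then ihull (fl_pt S P) (fl_pt S Q)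
     else (min (fst (fl_pt S P)) (fst (fl_pt S Q)), - ((- 31 * S) div 100)))"

definition fl'_iv :: "int \<Rightarrow> iv \<Rightarrow> iv \<Rightarrow> iv" where
  "fl'_iv S P Q = ihull (fl'_pt S P) (fl'_pt S Q)"

definition gam_iv :: "int \<Rightarrow> iv \<Rightarrow> iv \<Rightarrow> iv" where
  "gam_iv S P Q = ihull (gam_pt S P) (gam_pt S Q)"

definition sq1_iv :: "int \<Rightarrow> iv \<Rightarrow> iv" where
  "sq1_iv S x2 = imul S (iadd (S, S) x2) (iadd (S, S) x2)"

text \<open>Plain interval evaluation of the formula without monotonicity; its width is tolerable
  because it enters only the sign of \<open>jac'\<close>.\<close>

definition fl''_iv :: "int \<Rightarrow> iv \<Rightarrow> iv \<Rightarrow> iv" where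
  "fl''_iv S P Q = idiv S (imul S (imul S (iscale 3 (fst P, fst Q))
       (isub (iscale 2 (imul S (fst P, fst Q) (fst P, fst Q))) (iscale 3 (S, S)))) (rho_iv P Q))
     (sq1_iv S (imul S (fst P, fst Q) (fst P, fst Q)))"

definition gam'_iv :: "int \<Rightarrow> iv \<Rightarrow> iv \<Rightarrow> iv" where
  "gam'_iv S P Q = idiv S (imul S (iscale 3
       (isub (S, S) (iscale 4 (imul S (fst P, fst Q) (fst P, fst Q))))) (rho_iv P Q))
     (sq1_iv S (imul S (fst P, fst Q) (fst P, fst Q)))"

context
  fixes S :: int
  assumes S: "0 < S"
begin

lemma encl_arg: "encl S (fst P, fst P) (arg S P)"
  unfolding arg_def by (rule encl_point[OF S])

lemma arg_nonneg: "sample S P \<Longrightarrow> 0 \<le> arg S P"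
  using S by (simp add: sample_def arg_def)

lemma encl_rho_pt:
  assumes "sample S P" shows "encl S (rho_pt P) (rho (arg S P))"
proof -
  \<comment> \<open>Clearing denominators: two powers of \<open>S\<close> come from
    \<open>k / S\<close> and six from the cube of \<open>1 + (arg S P)\<^sup>2\<close>.\<close>
  have eq: "(of_int k / of_int S)\<^sup>2 * (1 + (arg S P)\<^sup>2) ^ 3 = of_int (k\<^sup>2 * (S\<^sup>2 + (fst P)\<^sup>2) ^ 3) / (of_int (S ^ 8) :: real)" for k
  proof -
    have "1 + (arg S P)\<^sup>2 = (of_int (S\<^sup>2 + (fst P)\<^sup>2) :: real) / (of_int S)\<^sup>2"
      using S by (simp add: arg_def field_simps)
    then show ?thesis
      by (simp add: power_divide power_mult[symmetric] power_add[symmetric])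
  qed
  have S8: "0 < S ^ 8" using S by simp
  have "of_int (snd P) / of_int S \<le> rho (arg S P)"
    using assms S8 unfolding sample_def
    by (intro le_rho) (simp only: eq divide_le_eq_1_pos of_int_0_less_iff of_int_le_iff)
  moreover have "rho (arg S P) \<le> of_int (snd P + 1) / of_int S"
    using assms S8 S unfolding sample_def
    by (intro rho_le) (simp, simp only: eq le_divide_eq_1_pos of_int_0_less_iff of_int_le_iff)
  ultimately show ?thesis
    using S by (simp add: encl_def rho_pt_def field_simps)
qed

lemma encl_sq_pt: "encl S (sq_pt S P) ((arg S P)\<^sup>2)"
  unfolding sq_pt_def power2_eq_square by (intro encl_mul S encl_arg)

lemma encl_fl_pt: "sample S P \<Longrightarrow> encl S (fl_pt S P) (fl (arg S P))"
  unfolding fl_pt_def fl_def by (intro encl_mul encl_sub encl_arg encl_rho_pt encl_eighth S)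

lemma iadd_one_pos:
  assumes "0 \<le> fst J" shows "0 < fst (iadd (S, S) J)"
  using S assms by (simp add: iadd_def)

lemma iround_nonneg: "0 < k \<Longrightarrow> 0 \<le> fst J \<Longrightarrow> 0 \<le> fst (iround k J)"
  by (simp add: iround_def pos_imp_zdiv_nonneg_iff)

lemma imul_nonneg:
  assumes "0 \<le> fst I" "0 \<le> fst J" "fst I \<le> snd I" "fst J \<le> snd J" shows "0 \<le> fst (imul S I J)"
  unfolding imul_def using assms S
  by (intro iround_nonneg) (auto simp: ihull_def)

lemma encl_fl'_pt:
  assumes "sample S P" shows "encl S (fl'_pt S P) (fl' (arg S P))"
proof -
  have "0 < fst (iadd (S, S) (sq_pt S P))"
    using assms by (intro iadd_one_pos) (auto simp: sq_pt_def sample_def intro!: imul_nonneg)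
  then show ?thesis
    unfolding fl'_pt_def fl'_def
    using encl_scale[OF S, of 2 "sq_pt S P" "(arg S P)\<^sup>2"] assms
    by (intro encl_sub encl_div encl_mul encl_rho_pt encl_add encl_one encl_sq_pt encl_eighth S)
       (auto intro: encl_sq_pt)
qed

lemma encl_gam_pt:
  assumes "sample S P" shows "encl S (gam_pt S P) (gam (arg S P))"
proof -
  have "0 < fst (iadd (S, S) (sq_pt S P))"
    using assms by (intro iadd_one_pos) (auto simp: sq_pt_def sample_def intro!: imul_nonneg)
  moreover have "encl S (iscale 3 (imul S (fst P, fst P) (rho_pt P))) (of_int 3 * (arg S P * rho (arg S P)))"
    using assms by (intro encl_scale encl_mul encl_rho_pt encl_arg S) auto
  ultimately show ?thesis
    unfolding gam_pt_def gam_def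
    by (intro encl_div encl_add encl_one encl_sq_pt S) (simp_all add: mult.assoc)
qed

context
  fixes P Q :: iv and x :: real
  assumes PQ: "segment S P Q" and x: "encl S (fst P, fst Q) x"
begin

lemma arg_le: "arg S P \<le> x" "x \<le> arg S Q" "0 \<le> arg S P" "0 \<le> x"
proof -
  show *: "arg S P \<le> x" "x \<le> arg S Q"
    using x S by (auto simp: encl_def arg_def field_simps)
  show "0 \<le> arg S P"
    using PQ by (auto simp: segment_def arg_nonneg)
  with * show "0 \<le> x" by linarith
qed

lemma samples: "sample S P" "sample S Q"
  using PQ by (auto simp: segment_def)

lemma encl_rho_iv: "encl S (rho_iv P Q) (rho x)"
proof -
  have "of_int S * rho x \<le> of_int S * rho (arg S P)" "of_int S * rho (arg S Q) \<le> of_int S * rho x"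
    using S rho_le_iff[of "arg S P" x] rho_le_iff[of x "arg S Q"] arg_le by (auto intro!: mult_left_mono)
  then show ?thesis
    using encl_rho_pt[OF samples(1)] encl_rho_pt[OF samples(2)]
    by (auto simp: encl_def rho_pt_def rho_iv_def)
qed

lemma encl_fl_iv: "encl S (fl_iv S P Q) (fl x)"
proof (cases "5 * fst Q \<le> 3 * S \<or> 61 * S \<le> 100 * fst P")
  case True
  have "fl x \<le> max (fl (arg S P)) (fl (arg S Q))"
    using True
  proof
    assume "5 * fst Q \<le> 3 * S"
    then have "(of_int (5 * fst Q) :: real) \<le> of_int (3 * S)"
      by (simp only: of_int_le_iff)
    then have "arg S Q \<le> 3 / 5"
      using S by (simp add: arg_def field_simps)
    then show ?thesis
      using fl_mono[of x "arg S Q"] arg_le by simp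
  next
    assume "61 * S \<le> 100 * fst P"
    then have "(of_int (61 * S) :: real) \<le> of_int (100 * fst P)"
      by (simp only: of_int_le_iff)
    then have "61 / 100 \<le> arg S P"
      using S by (simp add: arg_def field_simps)
    then show ?thesis
      using fl_antimono[of "arg S P" x] arg_le by simp
  qed
  then show ?thesis
    using True fl_ge_min[of "arg S P" x "arg S Q"] arg_le encl_fl_pt[OF samples(1)] encl_fl_pt[OF samples(2)]
    by (auto simp: fl_iv_def intro!: encl_hull[OF S, of _ "fl (arg S P)" _ "fl (arg S Q)"])
next
  case False
  have "encl S (ihull (fl_pt S P) (fl_pt S Q)) (min (fl (arg S P)) (fl (arg S Q)))"
    using encl_fl_pt[OF samples(1)] encl_fl_pt[OF samples(2)] by (auto intro!: encl_hull[OF S, of _ "fl (arg S P)" _ "fl (arg S Q)"])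
  moreover have "of_int S * min (fl (arg S P)) (fl (arg S Q)) \<le> of_int S * fl x"
    using S fl_ge_min[of "arg S P" x "arg S Q"] arg_le by (intro mult_left_mono) auto
  moreover have "of_int S * fl x \<le> of_int S * (31 / 100)"
    using S fl_le[of x] arg_le by (intro mult_left_mono) auto
  moreover have "of_int S * (31 / 100 :: real) \<le> of_int (- ((- 31 * S) div 100))"
    using le_neg_div[of 100 "31 * S"] by simp
  ultimately show ?thesis
    using False by (auto simp: fl_iv_def encl_def ihull_def)
qed

lemma encl_fl'_iv:
  assumes "50 * fst Q \<le> 61 * S \<or> 123 * S \<le> 100 * fst P"
  shows "encl S (fl'_iv S P Q) (fl' x)"
proof -
  have "(of_int (50 * fst Q) :: real) \<le> of_int (61 * S) \<or> (of_int (123 * S) :: real) \<le> of_int (100 * fst P)"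
    using assms by (simp only: of_int_le_iff)
  then have "arg S Q \<le> 61 / 50 \<or> 123 / 100 \<le> arg S P"
    using S by (auto simp: arg_def field_simps)
  then have "(\<forall>x. arg S P \<le> x \<and> x \<le> arg S Q \<longrightarrow> 0 \<le> fl'' x) \<or> (\<forall>x. arg S P \<le> x \<and> x \<le> arg S Q \<longrightarrow> fl'' x \<le> 0)"
    using fl''_nonpos fl''_nonneg arg_le(3) by force
  from between_if_monotone[OF has_derivative_fl' this arg_le(1,2)]
  show ?thesis
    unfolding fl'_iv_def using encl_fl'_pt[OF samples(1)] encl_fl'_pt[OF samples(2)] by (intro encl_hull[OF S]) auto
qed

lemma encl_gam_iv:
  assumes "2 * fst Q \<le> S \<or> S \<le> 2 * fst P"
  shows "encl S (gam_iv S P Q) (gam x)"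
proof -
  have "(of_int (2 * fst Q) :: real) \<le> of_int S \<or> (of_int S :: real) \<le> of_int (2 * fst P)"
    using assms by (simp only: of_int_le_iff)
  then have "arg S Q \<le> 1 / 2 \<or> 1 / 2 \<le> arg S P"
    using S by (auto simp: arg_def field_simps)
  then have "(\<forall>x. arg S P \<le> x \<and> x \<le> arg S Q \<longrightarrow> 0 \<le> gam' x) \<or> (\<forall>x. arg S P \<le> x \<and> x \<le> arg S Q \<longrightarrow> gam' x \<le> 0)"
    using gam'_nonpos gam'_nonneg arg_le(3) by force
  from between_if_monotone[OF has_derivative_gam this arg_le(1,2)]
  show ?thesis
    unfolding gam_iv_def using encl_gam_pt[OF samples(1)] encl_gam_pt[OF samples(2)] by (intro encl_hull[OF S]) auto
qed

lemma encl_sq_iv: "encl S (imul S (fst P, fst Q) (fst P, fst Q)) (x\<^sup>2)"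
  unfolding power2_eq_square using x by (intro encl_mul S)

lemma encl_sq1_iv: "encl S (sq1_iv S (imul S (fst P, fst Q) (fst P, fst Q))) ((1 + x\<^sup>2)\<^sup>2)"
  unfolding sq1_iv_def power2_eq_square[of "1 + x\<^sup>2"] by (intro encl_mul encl_add encl_one encl_sq_iv S)

lemma encl_gam'_iv:
  assumes "0 < fst (sq1_iv S (imul S (fst P, fst Q) (fst P, fst Q)))"
  shows "encl S (gam'_iv S P Q) (gam' x)"
proof -
  have "encl S (iscale 3 (isub (S, S) (iscale 4 (imul S (fst P, fst Q) (fst P, fst Q)))))
     (of_int 3 * (1 - of_int 4 * x\<^sup>2))"
    by (intro encl_scale encl_sub encl_one encl_sq_iv S) auto
  then show ?thesis
    unfolding gam'_iv_def gam'_def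
    by (intro encl_div encl_mul encl_rho_iv encl_sq1_iv S assms) auto
qed

lemma encl_fl''_iv:
  assumes "0 < fst (sq1_iv S (imul S (fst P, fst Q) (fst P, fst Q)))"
  shows "encl S (fl''_iv S P Q) (fl'' x)"
proof -
  have "encl S (isub (iscale 2 (imul S (fst P, fst Q) (fst P, fst Q))) (iscale 3 (S, S)))
     (of_int 2 * x\<^sup>2 - of_int 3 * 1)"
    by (intro encl_scale encl_sub encl_one encl_sq_iv S) auto
  moreover have "encl S (iscale 3 (fst P, fst Q)) (of_int 3 * x)"
    using x by (intro encl_scale S) auto
  ultimately show ?thesis
    unfolding fl''_iv_def fl''_def
    by (intro encl_div encl_mul encl_rho_iv encl_sq1_iv S assms) auto
qed

end
end

section \<open>Enclosures along the curve\<close>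

definition kcurve_iv :: "int \<Rightarrow> iv \<Rightarrow> iv \<Rightarrow> iv \<Rightarrow> iv \<Rightarrow> iv \<Rightarrow> iv" where
  "kcurve_iv S D A0 A1 B0 B1 = iadd (imul S (fl_iv S A0 A1) (isub (rho_iv A0 A1) D))
     (imul S (fl_iv S B0 B1) (isub (rho_iv B0 B1) D))"

text \<open>For a between the arguments of A0 and A1 the check places phi a - a between d0 / S and d1 / S; the points Bij
  have argument Ai + dj.\<close>

definition located :: "int \<Rightarrow> int \<Rightarrow> int \<Rightarrow> iv \<Rightarrow> iv \<Rightarrow> iv \<Rightarrow> iv \<Rightarrow> iv \<Rightarrow> iv \<Rightarrow> bool" where
  "located S d0 d1 A0 A1 B00 B10 B01 B11 \<longleftrightarrow>
     0 < d0 \<and> 0 < d1 \<and> segment S A0 A1 \<and> segment S B00 B10 \<and> segment S B01 B11 \<and>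
     fst B00 = fst A0 + d0 \<and> fst B10 = fst A1 + d0 \<and> fst B01 = fst A0 + d1 \<and> fst B11 = fst A1 + d1 \<and>
     snd (kcurve_iv S (icube S d0 d0) A0 A1 B00 B10) < 0 \<and>
     0 < fst (kcurve_iv S (icube S d1 d1) A0 A1 B01 B11)"

text \<open>Two enclosures are intersected: one from the definition of \<open>nu\<close>, one from
  the sum of the two kite equations, in which the inverse cube \<open>D\<close> cancels along with
  its width.\<close>

definition nu_iv1 :: "int \<Rightarrow> iv \<Rightarrow> iv \<Rightarrow> iv \<Rightarrow> iv \<Rightarrow> iv \<Rightarrow> iv \<Rightarrow> iv" where
  "nu_iv1 S d D ra rb fa fb = iinter (idiv S (imul S d (isub D rb)) fa)
     (idiv S (imul S d (isub ra rb)) (iadd fa fb))"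

definition nu_iv :: "int \<Rightarrow> int \<Rightarrow> int \<Rightarrow> iv \<Rightarrow> iv \<Rightarrow> iv \<Rightarrow> iv \<Rightarrow> iv" where
  "nu_iv S d0 d1 A0 A1 B0 B1 = nu_iv1 S (d0, d1) (icube S d0 d1) (rho_iv A0 A1) (rho_iv B0 B1)
     (fl_iv S A0 A1) (fl_iv S B0 B1)"

definition jac_iv1 :: "int \<Rightarrow> iv \<Rightarrow> iv \<Rightarrow> iv \<Rightarrow> iv \<Rightarrow> iv \<Rightarrow> iv \<Rightarrow> iv \<Rightarrow> iv" where
  "jac_iv1 S D ra rb p q e g =
     iadd (iadd (imul S (iscale 2 D) (iadd (iadd p e) (isub q g)))
                (iadd (imul S (iadd p e) ra) (imul S (isub q g) rb)))
          (iadd (imul S p q) (imul S e g))"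

definition p_iv :: "int \<Rightarrow> int \<Rightarrow> int \<Rightarrow> iv \<Rightarrow> iv \<Rightarrow> iv \<Rightarrow> iv \<Rightarrow> iv" where
  "p_iv S d0 d1 A0 A1 B0 B1 = ineg (imul S (nu_iv S d0 d1 A0 A1 B0 B1) (fl'_iv S A0 A1))"

definition q_iv :: "int \<Rightarrow> int \<Rightarrow> int \<Rightarrow> iv \<Rightarrow> iv \<Rightarrow> iv \<Rightarrow> iv \<Rightarrow> iv" where
  "q_iv S d0 d1 A0 A1 B0 B1 = ineg (imul S (nu_iv S d0 d1 A0 A1 B0 B1) (fl'_iv S B0 B1))"

definition jac_iv :: "int \<Rightarrow> int \<Rightarrow> int \<Rightarrow> iv \<Rightarrow> iv \<Rightarrow> iv \<Rightarrow> iv \<Rightarrow> iv" where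
  "jac_iv S d0 d1 A0 A1 B0 B1 = jac_iv1 S (icube S d0 d1) (rho_iv A0 A1) (rho_iv B0 B1)
     (p_iv S d0 d1 A0 A1 B0 B1) (q_iv S d0 d1 A0 A1 B0 B1)
     (imul S (d0, d1) (gam_iv S B0 B1)) (imul S (d0, d1) (gam_iv S A0 A1))"

definition jac_den_iv :: "int \<Rightarrow> int \<Rightarrow> int \<Rightarrow> iv \<Rightarrow> iv \<Rightarrow> iv \<Rightarrow> iv \<Rightarrow> iv" where
  "jac_den_iv S d0 d1 A0 A1 B0 B1 =
     iadd (imul S (fl_iv S A0 A1) (iadd (iadd (iscale 2 (icube S d0 d1)) (rho_iv A0 A1)) (q_iv S d0 d1 A0 A1 B0 B1)))
       (imul S (fl_iv S B0 B1) (isub (iadd (iscale 2 (icube S d0 d1)) (rho_iv B0 B1))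
          (imul S (d0, d1) (gam_iv S B0 B1))))"

definition slope_den_iv :: "int \<Rightarrow> int \<Rightarrow> int \<Rightarrow> iv \<Rightarrow> iv \<Rightarrow> iv" where
  "slope_den_iv S d0 d1 B0 B1 =
     isub (iadd (iscale 2 (icube S d0 d1)) (rho_iv B0 B1)) (imul S (d0, d1) (gam_iv S B0 B1))"

definition slope_iv :: "int \<Rightarrow> int \<Rightarrow> int \<Rightarrow> iv \<Rightarrow> iv \<Rightarrow> iv \<Rightarrow> iv \<Rightarrow> iv" where
  "slope_iv S d0 d1 A0 A1 B0 B1 =
     idiv S (iadd (iadd (iscale 2 (icube S d0 d1)) (rho_iv B0 B1)) (p_iv S d0 d1 A0 A1 B0 B1))
       (slope_den_iv S d0 d1 B0 B1)"

definition jac'_iv2 :: "int \<Rightarrow> iv \<Rightarrow> iv \<Rightarrow> iv \<Rightarrow> iv \<Rightarrow> iv \<Rightarrow> iv \<Rightarrow> iv \<Rightarrow> iv \<Rightarrow> iv \<Rightarrow> iv \<Rightarrow> iv \<Rightarrow> iv \<Rightarrow> iv \<Rightarrow> iv \<Rightarrow> iv \<Rightarrow> iv" where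
  "jac'_iv2 S d D ra rb ga gb P p q e g p' q' e' g' =
     iadd (iadd (iadd (iadd
       (iadd (imul S (ineg (idiv S (imul S (iscale 6 D) (isub P (S, S))) d)) (iadd (iadd p e) (isub q g)))
             (imul S (iscale 2 D) (iadd (iadd p' e') (isub q' g'))))
       (isub (imul S (iadd p' e') ra) (imul S (iadd p e) ga)))
       (isub (imul S (isub q' g') rb) (imul S (imul S (isub q g) gb) P)))
       (iadd (imul S p' q) (imul S p q')))
       (iadd (imul S e' g) (imul S e g'))"


definition jac'_iv1 :: "int \<Rightarrow> iv \<Rightarrow> iv \<Rightarrow> iv \<Rightarrow> iv \<Rightarrow> iv \<Rightarrow> iv \<Rightarrow> iv \<Rightarrow> iv \<Rightarrow> iv \<Rightarrow> iv \<Rightarrow> iv \<Rightarrow> iv \<Rightarrow> iv \<Rightarrow> iv \<Rightarrow> iv" where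
  "jac'_iv1 S d D ra rb n ga gb ga' gb' fa'' fb'' p q P =
     jac'_iv2 S d D ra rb ga gb P p q (imul S d gb) (imul S d ga)
       (ineg (imul S n fa'')) (ineg (imul S (imul S n fb'') P))
       (iadd (imul S (isub P (S, S)) gb) (imul S (imul S d gb') P))
       (iadd (imul S (isub P (S, S)) ga) (imul S d ga'))"

definition jac'_iv :: "int \<Rightarrow> int \<Rightarrow> int \<Rightarrow> iv \<Rightarrow> iv \<Rightarrow> iv \<Rightarrow> iv \<Rightarrow> iv" where
  "jac'_iv S d0 d1 A0 A1 B0 B1 = jac'_iv1 S (d0, d1) (icube S d0 d1) (rho_iv A0 A1) (rho_iv B0 B1)
     (nu_iv S d0 d1 A0 A1 B0 B1) (gam_iv S A0 A1) (gam_iv S B0 B1) (gam'_iv S A0 A1) (gam'_iv S B0 B1)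
     (fl''_iv S A0 A1) (fl''_iv S B0 B1) (p_iv S d0 d1 A0 A1 B0 B1) (q_iv S d0 d1 A0 A1 B0 B1)
     (slope_iv S d0 d1 A0 A1 B0 B1)"

text \<open>The positivity conditions concern the divisors in \<open>nu_iv\<close>. The last line
  puts both ranges where \<open>fl'\<close> and \<open>gam\<close> are monotone; its condition on
  \<open>B0\<close> also places the range of \<open>phi a\<close> to the right of 1/2, where
  \<open>gam\<close> decreases.\<close>

definition box_ok :: "int \<Rightarrow> int \<Rightarrow> int \<Rightarrow> iv \<Rightarrow> iv \<Rightarrow> iv \<Rightarrow> iv \<Rightarrow> bool" where
  "box_ok S d0 d1 A0 A1 B0 B1 \<longleftrightarrow> segment S A0 A1 \<and> segment S B0 B1 \<and> 0 < d0 \<and>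
     fst B0 = fst A0 + d0 \<and> fst B1 = fst A1 + d1 \<and>
     0 < fst (fl_iv S A0 A1) \<and> 0 < fst (iadd (fl_iv S A0 A1) (fl_iv S B0 B1)) \<and>
     50 * fst A1 \<le> 61 * S \<and> 123 * S \<le> 100 * fst B0 \<and> (2 * fst A1 \<le> S \<or> S \<le> 2 * fst A0)"

definition box'_ok :: "int \<Rightarrow> int \<Rightarrow> int \<Rightarrow> iv \<Rightarrow> iv \<Rightarrow> iv \<Rightarrow> iv \<Rightarrow> bool" where
  "box'_ok S d0 d1 A0 A1 B0 B1 \<longleftrightarrow> box_ok S d0 d1 A0 A1 B0 B1 \<and>
     0 < fst (slope_den_iv S d0 d1 B0 B1) \<and>
     0 < fst (sq1_iv S (imul S (fst A0, fst A1) (fst A0, fst A1))) \<and>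
     0 < fst (sq1_iv S (imul S (fst B0, fst B1) (fst B0, fst B1)))"

context
  fixes S :: int
  assumes S: "0 < S"
begin

lemma encl_kcurve_iv:
  assumes "segment S A0 A1" "segment S B0 B1" "encl S (fst A0, fst A1) a" "encl S (fst B0, fst B1) b"
    and "encl S D (1 / (b - a) ^ 3)"
  shows "encl S (kcurve_iv S D A0 A1 B0 B1) (kcurve a b)"
  unfolding kcurve_iv_def kcurve_def using assms
  by (intro encl_add encl_mul encl_sub encl_fl_iv encl_rho_iv S)

lemma encl_neg_pos: "encl S I x \<Longrightarrow> snd I < 0 \<Longrightarrow> x < 0" "encl S I x \<Longrightarrow> 0 < fst I \<Longrightarrow> 0 < x"
proof -
  assume *: "encl S I x"
  { assume "snd I < 0"
    then have "of_int S * x < 0"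
      using * by (auto simp: encl_def intro: le_less_trans)
    then show "x < 0"
      using S by (simp add: mult_less_0_iff)
  }
  { assume "0 < fst I"
    then have "0 < of_int S * x"
      using * by (auto simp: encl_def intro: less_le_trans[of 0 "of_int (fst I)"])
    then show "0 < x"
      using S by (simp add: zero_less_mult_iff)
  }
qed

end

context
  fixes S :: int and a :: real
  assumes S: "0 < S" and a: "0 < a" "a < sqrt 3"
begin

text \<open>The signs of \<open>kcurve\<close> hold uniformly over the box, and
  \<open>phi_less_iff\<close> turns them into bounds. Bounding the gap \<open>phi a - a\<close>
  instead of \<open>phi a\<close> keeps the width of the range of \<open>a\<close> out of the
  inverse cube.\<close>

lemma encl_phi:
  assumes loc: "located S d0 d1 A0 A1 B00 B10 B01 B11" and enc: "encl S (fst A0, fst A1) a"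
  shows "encl S (d0, d1) (phi a - a)"
proof -
  have S': "0 < (of_int S :: real)"
    using S by simp
  define x0 x1 :: real where "x0 = of_int d0 / of_int S" and "x1 = of_int d1 / of_int S"
  have x: "0 < x0" "0 < x1"
    using loc S' by (auto simp: located_def x0_def x1_def)
  have x01: "encl S (d0, d0) x0" "encl S (d1, d1) x1"
    unfolding x0_def x1_def by (rule encl_point[OF S])+
  have "encl S (fst B00, fst B10) (a + x0)" "encl S (fst B01, fst B11) (a + x1)"
    using loc encl_add[OF S enc x01(1)] encl_add[OF S enc x01(2)] by (auto simp: located_def iadd_def)
  then have "encl S (kcurve_iv S (icube S d0 d0) A0 A1 B00 B10) (kcurve a (a + x0))"
      "encl S (kcurve_iv S (icube S d1 d1) A0 A1 B01 B11) (kcurve a (a + x1))"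
    using loc enc encl_cube[OF S x01(1)] encl_cube[OF S x01(2)] by (auto simp: located_def intro!: encl_kcurve_iv[OF S])
  then have "kcurve a (a + x0) < 0" "0 < kcurve a (a + x1)"
    using loc encl_neg_pos[OF S] by (auto simp: located_def)
  then have "x0 < phi a - a" "phi a - a < x1"
    using phi_less_iff(1)[OF a, of "a + x0"] phi_less_iff(2)[OF a, of "a + x1"] x by auto
  then show ?thesis
    using S' by (simp add: encl_def x0_def x1_def field_simps)
qed

context
  fixes d0 d1 :: int and A0 A1 B0 B1 :: iv
  assumes ok: "box_ok S d0 d1 A0 A1 B0 B1" and a_in: "encl S (fst A0, fst A1) a"
    and d_in: "encl S (d0, d1) (phi a - a)"
begin

lemma b_in: "encl S (fst B0, fst B1) (phi a)"
  using encl_add[OF S a_in d_in] ok by (simp add: box_ok_def iadd_def)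

lemma segs: "segment S A0 A1" "segment S B0 B1"
  using ok by (auto simp: box_ok_def)

lemmas encl_a = encl_rho_iv[OF S segs(1) a_in] encl_fl_iv[OF S segs(1) a_in]
lemmas encl_b = encl_rho_iv[OF S segs(2) b_in] encl_fl_iv[OF S segs(2) b_in]

lemma encl_fl'_ab: "encl S (fl'_iv S A0 A1) (fl' a)" "encl S (fl'_iv S B0 B1) (fl' (phi a))"
  using encl_fl'_iv[OF S segs(1) a_in] encl_fl'_iv[OF S segs(2) b_in] ok by (auto simp: box_ok_def)

lemma encl_gam_ab: "encl S (gam_iv S A0 A1) (gam a)" "encl S (gam_iv S B0 B1) (gam (phi a))"
  using encl_gam_iv[OF S segs(1) a_in] encl_gam_iv[OF S segs(2) b_in] ok S by (auto simp: box_ok_def)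

lemma encl_D: "encl S (icube S d0 d1) (1 / (phi a - a) ^ 3)"
  using encl_cube[OF S d_in] ok by (simp add: box_ok_def)

lemma encl_2D: "encl S (iscale 2 (icube S d0 d1)) (2 / (phi a - a) ^ 3)"
  using encl_scale[OF S _ encl_D, of 2] by simp

lemma encl_nu: "encl S (nu_iv S d0 d1 A0 A1 B0 B1) (nu a)"
proof -
  note z = kcurve_zero[OF a phi[OF a]]
  have "nu a * (fl a + fl (phi a)) = (phi a - a) * (rho a - rho (phi a))"
    using nu(1,2)[OF a] by (simp add: algebra_simps)
  then have "nu a = (phi a - a) * (rho a - rho (phi a)) / (fl a + fl (phi a))"
    using z by (simp add: field_simps)
  moreover have "encl S (idiv S (imul S (d0, d1) (isub (icube S d0 d1) (rho_iv B0 B1))) (fl_iv S A0 A1)) (nu a)"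
    unfolding nu_def using ok by (intro encl_div encl_mul encl_sub encl_D encl_a encl_b d_in S) (simp add: box_ok_def)
  moreover have "encl S (idiv S (imul S (d0, d1) (isub (rho_iv A0 A1) (rho_iv B0 B1))) (iadd (fl_iv S A0 A1) (fl_iv S B0 B1)))
      ((phi a - a) * (rho a - rho (phi a)) / (fl a + fl (phi a)))"
    using ok by (intro encl_div encl_mul encl_sub encl_add encl_a encl_b d_in S) (simp add: box_ok_def)
  ultimately show ?thesis
    unfolding nu_iv_def nu_iv1_def by (intro encl_inter S) simp_all
qed

lemma encl_pq:
  "encl S (p_iv S d0 d1 A0 A1 B0 B1) (- (nu a * fl' a))"
  "encl S (q_iv S d0 d1 A0 A1 B0 B1) (- (nu a * fl' (phi a)))"
  unfolding p_iv_def q_iv_def by (intro encl_neg encl_mul encl_nu encl_fl'_ab S)+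

lemma encl_eg:
  "encl S (imul S (d0, d1) (gam_iv S B0 B1)) ((phi a - a) * gam (phi a))"
  "encl S (imul S (d0, d1) (gam_iv S A0 A1)) ((phi a - a) * gam a)"
  by (intro encl_mul d_in encl_gam_ab S)+

lemma encl_jac: "encl S (jac_iv S d0 d1 A0 A1 B0 B1) (jac a (phi a) (nu a))"
proof -
  let ?p = "- (nu a * fl' a)" and ?q = "- (nu a * fl' (phi a))"
  let ?e = "(phi a - a) * gam (phi a)" and ?g = "(phi a - a) * gam a" and ?D = "2 / (phi a - a) ^ 3"
  \<comment> \<open>The product of the two sums of inverse cube and \<open>rho\<close> occurs in
    both halves of \<open>jac\<close> and cancels. Interval evaluation of the uncancelled difference
    would count its width twice.\<close>
  have "jac a (phi a) (nu a) = ?D * ((?p + ?e) + (?q - ?g)) + ((?p + ?e) * rho a + (?q - ?g) * rho (phi a))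
      + (?p * ?q + ?e * ?g)"
  proof -
    have "(D + rb + p) * (D + ra + q) - (D + rb - e) * (D + ra + g) =
       D * ((p + e) + (q - g)) + ((p + e) * ra + (q - g) * rb) + (p * q + e * g)" for D ra rb p q e g :: real
      by (simp add: algebra_simps)
    from this[of ?D "rho (phi a)" ?p "rho a" ?q ?e ?g] show ?thesis
      by (simp add: jac_def)
  qed
  then show ?thesis
    unfolding jac_iv_def jac_iv1_def
    by (simp only:) (intro encl_add encl_sub encl_mul encl_2D encl_pq encl_a encl_b encl_gam_ab d_in S)
qed

lemma encl_jac_den: "encl S (jac_den_iv S d0 d1 A0 A1 B0 B1) (jac_den a (phi a) (nu a))"
proof -
  have "jac_den a (phi a) (nu a) = fl a * (2 / (phi a - a) ^ 3 + rho a + - (nu a * fl' (phi a)))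
     + fl (phi a) * (2 / (phi a - a) ^ 3 + rho (phi a) - (phi a - a) * gam (phi a))"
    by (simp add: jac_den_def)
  then show ?thesis
    unfolding jac_den_iv_def
    by (simp only:) (intro encl_add encl_sub encl_mul encl_2D encl_pq encl_a encl_b encl_gam_ab d_in S)
qed

lemma encl_jac':
  assumes "box'_ok S d0 d1 A0 A1 B0 B1"
  shows "encl S (jac'_iv S d0 d1 A0 A1 B0 B1)
    (jac' a (phi a) (nu a) (slope_num a (phi a) (nu a) / slope_den a (phi a)))"
proof -
  define P where "P = slope_num a (phi a) (nu a) / slope_den a (phi a)"
  have "encl S (slope_den_iv S d0 d1 B0 B1) (slope_den a (phi a))"
    unfolding slope_den_iv_def slope_den_def by (intro encl_sub encl_add encl_2D encl_b encl_eg S)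
  moreover have "slope_num a (phi a) (nu a) = 2 / (phi a - a) ^ 3 + rho (phi a) + - (nu a * fl' a)"
    by (simp add: slope_num_def)
  ultimately have P: "encl S (slope_iv S d0 d1 A0 A1 B0 B1) P"
    unfolding slope_iv_def P_def using assms
    by (simp only: box'_ok_def) (intro encl_div encl_add encl_2D encl_b encl_pq S; simp)
  have F: "encl S (fl''_iv S A0 A1) (fl'' a)" "encl S (fl''_iv S B0 B1) (fl'' (phi a))"
    and G: "encl S (gam'_iv S A0 A1) (gam' a)" "encl S (gam'_iv S B0 B1) (gam' (phi a))"
    using encl_fl''_iv[OF S segs(1) a_in] encl_fl''_iv[OF S segs(2) b_in]
      encl_gam'_iv[OF S segs(1) a_in] encl_gam'_iv[OF S segs(2) b_in] assms by (auto simp: box'_ok_def)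
  have D6: "encl S (iscale 6 (icube S d0 d1)) (6 * (1 / (phi a - a) ^ 3))"
    using encl_scale[OF S _ encl_D, of 6] by simp
  have D2: "encl S (iscale 2 (icube S d0 d1)) (2 * (1 / (phi a - a) ^ 3))"
    using encl_2D by simp
  have pos: "0 < fst (d0, d1)"
    using ok by (simp add: box_ok_def)
  show ?thesis
    unfolding jac'_iv_def jac'_iv1_def jac'_iv2_def jac'_def Let_def P_def[symmetric]
    by (intro encl_add encl_sub encl_mul encl_neg encl_div encl_one D6 D2 P F G encl_pq encl_eg encl_a encl_b
        encl_gam_ab encl_nu d_in pos S)
qed

end
end

section \<open>Sign checks on boxes\<close>

definition jac_phi :: "real \<Rightarrow> real" where
  "jac_phi a = jac a (phi a) (nu a)"

text \<open>The bound 61/50 on the right end also ensures \<open>a < sqrt 3\<close>. Of the four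
  corner samples, \<open>B00\<close> and \<open>B11\<close> are the smallest and the largest, so
  they enclose \<open>phi a\<close>.\<close>

definition boxed :: "int \<Rightarrow> int \<Rightarrow> int \<Rightarrow> iv \<Rightarrow> iv \<Rightarrow> iv \<Rightarrow> iv \<Rightarrow> iv \<Rightarrow> iv \<Rightarrow> bool" where
  "boxed S d0 d1 A0 A1 B00 B10 B01 B11 \<longleftrightarrow> 0 < S \<and> 0 < fst A0 \<and> 50 * fst A1 \<le> 61 * S \<and>
     located S d0 d1 A0 A1 B00 B10 B01 B11 \<and> box_ok S d0 d1 A0 A1 B00 B11"

definition jac_neg_box :: "int \<Rightarrow> int \<Rightarrow> int \<Rightarrow> iv \<Rightarrow> iv \<Rightarrow> iv \<Rightarrow> iv \<Rightarrow> iv \<Rightarrow> iv \<Rightarrow> bool" where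
  "jac_neg_box S d0 d1 A0 A1 B00 B10 B01 B11 \<longleftrightarrow>
     boxed S d0 d1 A0 A1 B00 B10 B01 B11 \<and> snd (jac_iv S d0 d1 A0 A1 B00 B11) < 0"

definition jac_pos_box :: "int \<Rightarrow> int \<Rightarrow> int \<Rightarrow> iv \<Rightarrow> iv \<Rightarrow> iv \<Rightarrow> iv \<Rightarrow> iv \<Rightarrow> iv \<Rightarrow> bool" where
  "jac_pos_box S d0 d1 A0 A1 B00 B10 B01 B11 \<longleftrightarrow>
     boxed S d0 d1 A0 A1 B00 B10 B01 B11 \<and> 0 < fst (jac_iv S d0 d1 A0 A1 B00 B11)"

lemma less_sqrt3I: "x \<le> 61 / 50 \<Longrightarrow> x < sqrt 3"
  by (rule le_less_trans[OF _ real_less_rsqrt[of "61 / 50"]]) (auto simp: power_divide)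

lemma boxedD:
  assumes "boxed S d0 d1 A0 A1 B00 B10 B01 B11" "of_int (fst A0) / of_int S \<le> a" "a \<le> of_int (fst A1) / of_int S"
  shows "0 < S" "0 < a" "a < sqrt 3" "box_ok S d0 d1 A0 A1 B00 B11" "encl S (fst A0, fst A1) a"
    "encl S (d0, d1) (phi a - a)"
proof -
  show S: "0 < S" and ok: "box_ok S d0 d1 A0 A1 B00 B11"
    using assms by (auto simp: boxed_def)
  have "0 < (of_int (fst A0) / of_int S :: real)"
    using assms by (simp add: boxed_def)
  then show a0: "0 < a"
    using assms by linarith
  have "(of_int (50 * fst A1) :: real) \<le> of_int (61 * S)"
    using assms by (simp only: of_int_le_iff boxed_def)
  then have "of_int (fst A1) / of_int S \<le> (61 / 50 :: real)"
    using S by (simp add: field_simps)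
  then show a1: "a < sqrt 3"
    using assms(3) by (intro less_sqrt3I) linarith
  show enc: "encl S (fst A0, fst A1) a"
    using S assms(2,3) by (simp add: encl_def field_simps)
  show "encl S (d0, d1) (phi a - a)"
  proof (rule encl_phi[OF S a0 a1 _ enc])
    show "located S d0 d1 A0 A1 B00 B10 B01 B11"
      using assms(1) by (simp add: boxed_def)
  qed
qed

lemma jac_neg_boxD:
  assumes "jac_neg_box S d0 d1 A0 A1 B00 B10 B01 B11" "of_int (fst A0) / of_int S \<le> a" "a \<le> of_int (fst A1) / of_int S"
  shows "jac_phi a < 0"
proof -
  have "boxed S d0 d1 A0 A1 B00 B10 B01 B11"
    using assms by (simp add: jac_neg_box_def)
  note D = boxedD[OF this assms(2,3)]
  show ?thesis
    using encl_neg_pos(1)[OF D(1) encl_jac[OF D]] assms(1) by (simp add: jac_neg_box_def jac_phi_def)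
qed

lemma jac_pos_boxD:
  assumes "jac_pos_box S d0 d1 A0 A1 B00 B10 B01 B11" "of_int (fst A0) / of_int S \<le> a" "a \<le> of_int (fst A1) / of_int S"
  shows "0 < jac_phi a"
proof -
  have "boxed S d0 d1 A0 A1 B00 B10 B01 B11"
    using assms by (simp add: jac_pos_box_def)
  note D = boxedD[OF this assms(2,3)]
  show ?thesis
    using encl_neg_pos(2)[OF D(1) encl_jac[OF D]] assms(1) by (simp add: jac_pos_box_def jac_phi_def)
qed

text \<open>The numbers are the scale, the bounds for \<open>phi a - a\<close>, the samples at both
  ends of the range of \<open>a\<close>, and the corner samples. These boxes cover 1/8 to 29/50 and
  the positive ones 13/20 to 6/5; they are narrower next to the gap that contains the zero of
  \<open>jac\<close>.\<close>

lemma jac_neg_box_1: "jac_neg_box 10000 11375 12250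
    (1250, 9770) (2100, 9373) (12625, 2393) (13475, 2116) (13500, 2108) (14350, 1868)"
  by code_simp

lemma jac_neg_box_2: "jac_neg_box 10000 11125 11800
    (2100, 9373) (3000, 8787) (13225, 2193) (14125, 1929) (13900, 1991) (14800, 1754)"
  by code_simp

lemma jac_neg_box_3: "jac_neg_box 10000 11025 11675
    (3000, 8787) (4000, 8004) (14025, 1956) (15025, 1700) (14675, 1785) (15675, 1555)"
  by code_simp

lemma jac_neg_box_4: "jac_neg_box 10000 11075 11700
    (4000, 8004) (5000, 7155) (15075, 1689) (16075, 1473) (15700, 1550) (16700, 1355)"
  by code_simp

lemma jac_neg_box_5: "jac_neg_box 10000 11300 11625
    (5000, 7155) (5500, 6727) (16300, 1429) (16800, 1338) (16625, 1369) (17125, 1282)"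
  by code_simp

lemma jac_neg_box_6: "jac_neg_box 10000 11425 11625
    (5500, 6727) (5800, 6472) (16925, 1316) (17225, 1265) (17125, 1282) (17425, 1233)"
  by code_simp

lemma jac_pos_box_1: "jac_pos_box 10000 11575 11800
    (6500, 5894) (6800, 5654) (18075, 1134) (18375, 1092) (18300, 1102) (18600, 1061)"
  by code_simp

lemma jac_pos_box_2: "jac_pos_box 10000 11500 12025
    (6800, 5654) (7500, 5120) (18300, 1102) (19000, 1010) (18825, 1032) (19525, 947)"
  by code_simp

lemma jac_pos_box_3: "jac_pos_box 10000 11450 12275
    (7500, 5120) (8500, 4423) (18950, 1016) (19950, 899) (19775, 918) (20775, 815)"
  by code_simp

lemma jac_pos_box_4: "jac_pos_box 10000 11125 12575
    (8500, 4423) (10000, 3535) (19625, 935) (21125, 783) (21075, 787) (22575, 664)"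
  by code_simp

lemma jac_pos_box_5: "jac_pos_box 10000 10900 12100
    (10000, 3535) (11000, 3043) (20900, 804) (21900, 716) (22100, 700) (23100, 626)"
  by code_simp

lemma jac_pos_box_6: "jac_pos_box 10000 10100 11550
    (11000, 3043) (12000, 2623) (21100, 785) (22100, 700) (22550, 666) (23550, 597)"
  by code_simp

text \<open>The remaining gap from 29/50 to 13/20 contains the zero of \<open>jac\<close>, so no
  sign of \<open>jac\<close> can be certified on all of it; the sign of its derivative can.\<close>

lemma jac'_box: "boxed 10000 11375 11850
    (5800, 6472) (6500, 5894) (17175, 1273) (17875, 1163) (17650, 1197) (18350, 1095) \<and>
    box'_ok 10000 11375 11850
      (5800, 6472) (6500, 5894) (17175, 1273) (18350, 1095) \<and>
    0 < fst (jac'_iv 10000 11375 11850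
      (5800, 6472) (6500, 5894) (17175, 1273) (18350, 1095))"
  by code_simp

text \<open>A degenerate box, both ends of the range of \<open>a\<close> being the same point. So
  close to the zero the scale 10^4 would not resolve the sign.\<close>

lemma peak_left_box: "jac_neg_box 1000000000000 1160772906176 1160772906191
    (613857637000, 618990072679) (613857637000, 618990072679) (1774630543176, 118313858032) (1774630543176, 118313858032) (1774630543191, 118313858030) (1774630543191, 118313858030)"
  by code_simp

text \<open>The scale 10^18 yields \<open>nu\<close> within 3 * 10^-16 at a rational point, from
  which the digits of m0 are derived.\<close>

lemma peak_left_fine_box: "boxed 1000000000000000000 1160772906182995290 1160772906182995306
    (613857637000000000, 618990072679335797) (613857637000000000, 618990072679335797) (1774630543182995290, 118313858031736211) (1774630543182995290, 118313858031736211) (1774630543182995306, 118313858031736209) (1774630543182995306, 118313858031736209) \<and>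
    1994588026390975700 \<le> fst (nu_iv 1000000000000000000 1160772906182995290 1160772906182995306
      (613857637000000000, 618990072679335797) (613857637000000000, 618990072679335797) (1774630543182995290, 118313858031736211) (1774630543182995306, 118313858031736209)) \<and>
    snd (nu_iv 1000000000000000000 1160772906182995290 1160772906182995306
      (613857637000000000, 618990072679335797) (613857637000000000, 618990072679335797) (1774630543182995290, 118313858031736211) (1774630543182995306, 118313858031736209)) \<le> 1994588026390976000"
  by code_simp

lemma peak_right_box: "jac_pos_box 1000000000000 1160772906343 1160772906358
    (613857638000, 618990071851) (613857638000, 618990071851) (1774630544343, 118313857855) (1774630544343, 118313857855) (1774630544358, 118313857853) (1774630544358, 118313857853)"
  by code_simp

text \<open>At scale 10^12 these integers say that \<open>jac\<close> is at most 10^-8 in absolute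
  value and \<open>jac_den\<close> at least 1/2 over the whole bracket, so the derivative of
  \<open>nu\<close> is at most 2 * 10^-8.\<close>

lemma peak_box: "boxed 1000000000000 1160772905942 1160772906591
    (613857637000, 618990072679) (613857638000, 618990071851) (1774630542942, 118313858068) (1774630543942, 118313857916) (1774630543591, 118313857969) (1774630544591, 118313857817) \<and>
    - 10000 \<le> fst (jac_iv 1000000000000 1160772905942 1160772906591
      (613857637000, 618990072679) (613857638000, 618990071851) (1774630542942, 118313858068) (1774630544591, 118313857817)) \<and>
    snd (jac_iv 1000000000000 1160772905942 1160772906591
      (613857637000, 618990072679) (613857638000, 618990071851) (1774630542942, 118313858068) (1774630544591, 118313857817)) \<le> 10000 \<and>
    500000000000 \<le> fst (jac_den_iv 1000000000000 1160772905942 1160772906591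
      (613857637000, 618990072679) (613857638000, 618990071851) (1774630542942, 118313858068) (1774630544591, 118313857817))"
  by code_simp

section \<open>The shape of the mass function\<close>

lemma jac_phi_neg_middle:
  assumes "1 / 8 \<le> a" "a \<le> 29 / 50" shows "jac_phi a < 0"
proof -
  consider "1 / 8 \<le> a \<and> a \<le> 21 / 100" | "21 / 100 \<le> a \<and> a \<le> 3 / 10" | "3 / 10 \<le> a \<and> a \<le> 2 / 5" | "2 / 5 \<le> a \<and> a \<le> 1 / 2" | "1 / 2 \<le> a \<and> a \<le> 11 / 20" | "11 / 20 \<le> a \<and> a \<le> 29 / 50"
    using assms by argo
  then show ?thesis
  proof cases
    case 1
    then show ?thesis by (intro jac_neg_boxD[OF jac_neg_box_1]) simp_all
  next
    case 2
    then show ?thesis by (intro jac_neg_boxD[OF jac_neg_box_2]) simp_all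
  next
    case 3
    then show ?thesis by (intro jac_neg_boxD[OF jac_neg_box_3]) simp_all
  next
    case 4
    then show ?thesis by (intro jac_neg_boxD[OF jac_neg_box_4]) simp_all
  next
    case 5
    then show ?thesis by (intro jac_neg_boxD[OF jac_neg_box_5]) simp_all
  next
    case 6
    then show ?thesis by (intro jac_neg_boxD[OF jac_neg_box_6]) simp_all
  qed
qed

lemma jac_phi_pos_middle:
  assumes "13 / 20 \<le> a" "a \<le> 6 / 5" shows "0 < jac_phi a"
proof -
  consider "13 / 20 \<le> a \<and> a \<le> 17 / 25" | "17 / 25 \<le> a \<and> a \<le> 3 / 4" | "3 / 4 \<le> a \<and> a \<le> 17 / 20" | "17 / 20 \<le> a \<and> a \<le> 1" | "1 \<le> a \<and> a \<le> 11 / 10" | "11 / 10 \<le> a \<and> a \<le> 6 / 5"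
    using assms by argo
  then show ?thesis
  proof cases
    case 1
    then show ?thesis by (intro jac_pos_boxD[OF jac_pos_box_1]) simp_all
  next
    case 2
    then show ?thesis by (intro jac_pos_boxD[OF jac_pos_box_2]) simp_all
  next
    case 3
    then show ?thesis by (intro jac_pos_boxD[OF jac_pos_box_3]) simp_all
  next
    case 4
    then show ?thesis by (intro jac_pos_boxD[OF jac_pos_box_4]) simp_all
  next
    case 5
    then show ?thesis by (intro jac_pos_boxD[OF jac_pos_box_5]) simp_all
  next
    case 6
    then show ?thesis by (intro jac_pos_boxD[OF jac_pos_box_6]) simp_all
  qed
qed

lemma jac'_pos:
  assumes "29 / 50 \<le> a" "a \<le> 13 / 20"
  shows "0 < jac' a (phi a) (nu a) (slope_num a (phi a) (nu a) / slope_den a (phi a))"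
proof -
  note box = jac'_box[THEN conjunct1] jac'_box[THEN conjunct2, THEN conjunct1] jac'_box[THEN conjunct2, THEN conjunct2]
  note D = boxedD[OF box(1), of a]
  have D': "0 < (10000::int)" "0 < a" "a < sqrt 3"
    "encl 10000 (fst (5800, 6472), fst (6500, 5894)) a" "encl 10000 (11375, 11850) (phi a - a)"
    using D assms by simp_all
  show ?thesis
    by (rule encl_neg_pos(2)[OF D'(1) encl_jac'[OF D'(1-3) _ D'(4,5) box(2)] box(3)])
      (use box(2) in \<open>simp add: box'_ok_def\<close>)
qed

definition peak_left :: real where "peak_left = 613857637 / 10 ^ 9"

definition peak_right :: real where "peak_right = 613857638 / 10 ^ 9"

lemma jac_phi_peak_left: "jac_phi peak_left < 0"
  using jac_neg_boxD[OF peak_left_box, of peak_left] by (simp add: peak_left_def)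

lemma jac_phi_peak_right: "0 < jac_phi peak_right"
  using jac_pos_boxD[OF peak_right_box, of peak_right] by (simp add: peak_right_def)

lemma nu_peak_left:
  "19945880263909757 / 10 ^ 16 \<le> nu peak_left" "nu peak_left \<le> 1994588026390976 / 10 ^ 15"
proof -
  note box = peak_left_fine_box[THEN conjunct1]
  note enc = encl_nu[OF boxedD[OF box, of peak_left]]
  show "19945880263909757 / 10 ^ 16 \<le> nu peak_left" "nu peak_left \<le> 1994588026390976 / 10 ^ 15"
    using enc peak_left_fine_box[THEN conjunct2] unfolding encl_def by (simp_all add: peak_left_def)
qed

lemma peak_bounds:
  assumes "peak_left \<le> a" "a \<le> peak_right"
  shows "\<bar>jac_phi a\<bar> \<le> 1 / 10 ^ 8" "1 / 2 \<le> jac_den a (phi a) (nu a)"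
proof -
  note D = boxedD[OF peak_box[THEN conjunct1], of a]
  show "\<bar>jac_phi a\<bar> \<le> 1 / 10 ^ 8" "1 / 2 \<le> jac_den a (phi a) (nu a)"
    using encl_jac[OF D] encl_jac_den[OF D] peak_box[THEN conjunct2] assms
    by (simp_all add: peak_left_def peak_right_def encl_def jac_phi_def abs_le_iff) linarith+
qed



section \<open>Estimates near the two ends\<close>

lemma phi_bounds_small:
  assumes a: "0 < a" "a \<le> 1 / 8" shows "5 / 4 < phi a" "phi a < sqrt 3"
proof -
  have a3: "a < sqrt 3"
    using a less_sqrt3I[of a] by simp
  note z = kcurve_zero[OF a(1) a3 phi[OF a(1) a3]]
  have s85: "8 / 5 < sqrt 3 - a"
    using real_less_rsqrt[of "1729 / 1000" 3] a by (simp add: power_divide)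
  have ra: "976 / 1000 \<le> rho a" "rho a \<le> 1"
  proof -
    have "976 / 1000 \<le> rho (1 / 8)"
      by (rule le_rho) (simp add: power_divide)
    then show "976 / 1000 \<le> rho a"
      using rho_le_iff[of a "1 / 8"] a by simp
    show "rho a \<le> 1"
      by (rule rho_le) simp_all
  qed
  show "5 / 4 < phi a"
  proof -
    \<comment> \<open>\<open>boxed\<close> demands a positive left end, but here \<open>a\<close>
      ranges down to 0; only the sign of \<open>kcurve\<close> at \<open>b = 5 / 4\<close> is
      wanted, so \<open>kcurve_iv\<close> is evaluated directly, split at 6/100.\<close>
    have enc: "encl 10000 (l, u) x" if "of_int l \<le> 10000 * x" "10000 * x \<le> of_int u" for l u x
      using that by (simp add: encl_def)
    have seg: "segment 10000 (0, 10000) (600, 9946)" "segment 10000 (600, 9946) (1250, 9770)"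
        "segment 10000 (12500, 2437) (12500, 2437)"
      and neg: "snd (kcurve_iv 10000 (icube 10000 11900 12500) (0, 10000) (600, 9946) (12500, 2437) (12500, 2437)) < 0"
       "snd (kcurve_iv 10000 (icube 10000 11250 11900) (600, 9946) (1250, 9770) (12500, 2437) (12500, 2437)) < 0"
      by code_simp+
    have "kcurve a (5 / 4) < 0"
    proof (cases "a \<le> 6 / 100")
      case True
      then have D: "encl 10000 (icube 10000 11900 12500) (1 / (5 / 4 - a) ^ 3)"
        using a by (intro encl_cube enc) auto
      show ?thesis
        by (rule encl_neg_pos(1)[OF _ encl_kcurve_iv[OF _ seg(1,3) enc enc D] neg(1)]) (use a True in auto)
    next
      case False
      then have D: "encl 10000 (icube 10000 11250 11900) (1 / (5 / 4 - a) ^ 3)"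
        using a by (intro encl_cube enc) auto
      show ?thesis
        by (rule encl_neg_pos(1)[OF _ encl_kcurve_iv[OF _ seg(2,3) enc enc D] neg(2)]) (use a False in auto)
    qed
    then show ?thesis
      using phi_less_iff(1)[OF a(1) a3, of "5 / 4"] a by simp
  qed
  show "phi a < sqrt 3"
  proof -
    \<comment> \<open>At \<open>b = sqrt 3\<close> the second product of \<open>kcurve\<close>
      vanishes together with \<open>fl\<close>, and the first is positive.\<close>
    have "1 / (sqrt 3 - a) ^ 3 \<le> 1 / (8 / 5) ^ 3"
      using s85 by (intro divide_left_mono power_mono) auto
    then have "0 < fl a * (rho a - 1 / (sqrt 3 - a) ^ 3)"
      using z(3) ra by (intro mult_pos_pos) (auto simp: power_divide)
    then have "0 < kcurve a (sqrt 3)"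
      by (simp add: kcurve_def fl_def rho_sqrt3)
    then show ?thesis
      using phi_less_iff(2)[OF a(1) a3, of "sqrt 3"] a3 by simp
  qed
qed

text \<open>For small \<open>a\<close> the ratio \<open>nu a\<close> is so large that the first
  factor of the first product of \<open>jac\<close> is negative; the other three factors are
  positive.\<close>

lemma jac_phi_neg_small:
  assumes a: "0 < a" "a \<le> 1 / 8" shows "jac_phi a < 0"
proof -
  have a3: "a < sqrt 3"
    using a less_sqrt3I[of a] by simp
  note p = phi[OF a(1) a3]
  define b where "b = phi a"
  define d where "d = b - a"
  define D where "D = 1 / d ^ 3"
  note z = kcurve_zero[OF a(1) a3 p, folded b_def, folded d_def, folded D_def]
  note n = nu[OF a(1) a3, folded b_def, folded d_def, folded D_def]
  note bb = phi_bounds_small[OF a, folded b_def]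
  have b5: "5 / 4 < b" and b3: "b < sqrt 3"
    by (rule bb)+
  have ra: "976 / 1000 \<le> rho a" "rho a \<le> 1"
  proof -
    have "976 / 1000 \<le> rho (1 / 8)"
      by (rule le_rho) (simp add: power_divide)
    then show "976 / 1000 \<le> rho a"
      using rho_le_iff[of a "1 / 8"] a by simp
    show "rho a \<le> 1"
      by (rule rho_le) simp_all
  qed
  have d: "9 / 8 \<le> d"
    using b5 a by (simp add: d_def)
  \<comment> \<open>Here \<open>b < sqrt 3\<close> is used: both sides of the kite equation are
    positive, which forces \<open>D < rho a\<close>, hence \<open>D < 1\<close>.\<close>
  have "0 < fl b * (D - rho b)"
    using z fl_sign(1)[of b] b3 b5 by (intro mult_pos_pos) auto
  then have Da: "D < rho a"
    using z(1,3) by (metis diff_gt_0_iff_gt zero_less_mult_pos)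
  have rb54: "rho (5 / 4) \<le> 2438 / 10000"
    by (rule rho_le) (simp_all add: power_divide)
  then have rb: "rho b \<le> 2438 / 10000"
    using rho_le_iff[of "5 / 4" b] b5 by simp
  have fla: "fl a \<le> 7 / 64"
    using mult_mono[of a "1 / 8" "rho a - 1 / 8" "7 / 8"] a ra by (simp add: fl_def)
  have flb: "fl b \<le> 1485 / 10000"
    using fl_antimono[of "5 / 4" b] b5 rb54 by (simp add: fl_def)
  have fl'a: "8 / 10 \<le> fl' a"
  proof -
    have "a\<^sup>2 \<le> 1 / 64"
      using power_mono[of a "1 / 8" 2] a by (simp add: power_divide)
    then have "62 / 65 \<le> (1 - 2 * a\<^sup>2) / (1 + a\<^sup>2)"
      using one_plus_sq_pos[of a] by (simp add: pos_le_divide_eq)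
    then have "976 / 1000 * (62 / 65) \<le> rho a * ((1 - 2 * a\<^sup>2) / (1 + a\<^sup>2))"
      using ra by (intro mult_mono) auto
    then show ?thesis
      unfolding fl'_def by simp
  qed
  \<comment> \<open>Adding the two equations for \<open>nu\<close> eliminates \<open>D\<close>. Then
    \<open>nu a * fl' a\<close> is at least 2.4, which exceeds the bound 2.2438 for
    \<open>2 * D + rho b\<close>.\<close>
  have nlow: "3 \<le> nu a"
  proof -
    have "nu a * (fl a + fl b) = d * (rho a - rho b)"
      using n(1,2) by (simp add: algebra_simps)
    moreover have "9 / 8 * (976 / 1000 - 2438 / 10000) \<le> d * (rho a - rho b)"
      using d ra rb by (intro mult_mono) auto
    moreover have "nu a * (fl a + fl b) \<le> nu a * (7 / 64 + 1485 / 10000)"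
      using n(3) fla flb by (intro mult_left_mono) auto
    ultimately show ?thesis by simp
  qed
  have "3 * (8 / 10) \<le> nu a * fl' a"
    using nlow fl'a by (intro mult_mono) auto
  then have X: "2 / d ^ 3 + rho b - nu a * fl' a < 0"
    using Da ra rb by (simp add: D_def)
  have "nu a * fl' b < 0"
    using n(3) fl'_neg[of b] b5 by (simp add: mult_pos_neg)
  then have Y: "0 < 2 / d ^ 3 + rho a - nu a * fl' b"
    using d ra zero_less_divide_iff[of 2 "d ^ 3"] by (simp add: add_pos_pos add_strict_increasing2)
  have Z: "0 < 2 / d ^ 3 + rho b - d * gam b"
    using slope_den_pos[OF a(1) p(1)] by (simp add: slope_den_def b_def d_def)
  have V: "0 < 2 / d ^ 3 + rho a + d * gam a"
    using d ra gam_pos[OF a(1)] by (intro add_pos_pos) auto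
  show ?thesis
    using mult_neg_pos[OF X Y] mult_pos_pos[OF Z V]
    by (simp add: jac_phi_def jac_def b_def[symmetric] d_def[symmetric])
qed

text \<open>If \<open>phi a\<close> were at most \<open>sqrt 3\<close>, then
  \<open>phi a - a < 1\<close> and the inverse cube would exceed \<open>rho a\<close>, giving the
  two sides of the kite equation incompatible signs. Beyond \<open>sqrt 3\<close> the negative sign
  of \<open>fl (phi a)\<close> yields the other two bounds.\<close>

lemma phi_bounds_large:
  assumes a: "6 / 5 \<le> a" "a < sqrt 3"
  shows "sqrt 3 < phi a" "rho a < 1 / (phi a - a) ^ 3" "phi a - a < 2"
proof -
  have a0: "0 < a" using a by simp
  note p = phi[OF a0 a(2)]
  note z = kcurve_zero[OF a0 a(2) p]
  have s3: "sqrt 3 < 9 / 5"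
    by (rule real_less_lsqrt) (auto simp: power_divide)
  have ra: "1 / 8 < rho a" "rho a \<le> 1"
    using rho_less_iff[of a "sqrt 3"] a0 a rho_le[of 1 a] by (auto simp: rho_sqrt3)
  show 1: "sqrt 3 < phi a"
  proof (rule ccontr)
    assume "\<not> sqrt 3 < phi a"
    then have "0 \<le> fl (phi a)" "phi a - a < 1"
      using fl_sign[of "phi a"] p a s3 a0 by (auto simp: not_less)
    moreover have "1 < 1 / (phi a - a) ^ 3"
      using p \<open>phi a - a < 1\<close> by (simp add: power_less_one_iff)
    ultimately have "fl a * (rho a - 1 / (phi a - a) ^ 3) < 0" "0 \<le> fl (phi a) * (1 / (phi a - a) ^ 3 - rho (phi a))"
      using ra z(2,3) by (auto intro: mult_pos_neg mult_nonneg_nonneg)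
    then show False
      using z(1) by simp
  qed
  have "fl (phi a) * (1 / (phi a - a) ^ 3 - rho (phi a)) < 0"
    using 1 fl_sign(2)[of "phi a"] p a0 z by (auto simp: mult_neg_pos)
  then show 2: "rho a < 1 / (phi a - a) ^ 3"
    using z(1,3) by (metis diff_gt_0_iff_gt mult_less_0_iff not_less_iff_gr_or_eq diff_less_0_iff_less)
  show "phi a - a < 2"
  proof (rule ccontr)
    assume "\<not> phi a - a < 2"
    then have "1 / (phi a - a) ^ 3 \<le> 1 / 2 ^ 3"
      by (intro divide_left_mono power_mono) auto
    then show False
      using 2 ra by simp
  qed
qed

text \<open>In the expansion of \<open>jac\<close> only \<open>G\<close> enters with a negative
  sign, and \<open>G\<close> is at most \<open>P + Q\<close>.\<close>

lemma jac_phi_pos_large: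
  assumes a: "6 / 5 \<le> a" "a < sqrt 3" shows "0 < jac_phi a"
proof -
  have a0: "0 < a" using a by simp
  define b where "b = phi a"
  define d where "d = b - a"
  define D where "D = 1 / d ^ 3"
  note p = phi[OF a0 a(2), folded b_def]
  note z = kcurve_zero[OF a0 a(2) p, folded d_def, folded D_def]
  note n = nu[OF a0 a(2), folded b_def, folded d_def, folded D_def]
  note bd = phi_bounds_large[OF a, folded b_def, folded d_def, folded D_def]
  have d: "0 < d" using p by (simp add: d_def)
  have b: "0 < b" "b < 4"
    using bd a real_less_lsqrt[of 2 3] a0 p by (auto simp: d_def)
  have ra: "1 / 8 < rho a" "rho a \<le> 263 / 1000"
  proof -
    show "1 / 8 < rho a"
      using rho_less_iff[of a "sqrt 3"] a0 a by (simp add: rho_sqrt3)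
    have "rho (6 / 5) \<le> 263 / 1000"
      by (rule rho_le) (simp_all add: power_divide)
    then show "rho a \<le> 263 / 1000"
      using rho_le_iff[of "6 / 5" a] a by simp
  qed
  have rb: "rho b < 1 / 8"
    using rho_less_iff[of "sqrt 3" b] bd b by (simp add: rho_sqrt3)
  have "14 / 1000 \<le> rho 4"
    by (rule le_rho) (simp add: power_divide)
  then have rb4: "14 / 1000 \<le> rho b"
    using rho_le_iff[of b 4] b by simp
  \<comment> \<open>The margin is thin: \<open>fl' b\<close> is at most
    \<open>- (14 / 1000 + 1 / 8)\<close>, that is -0.139, while \<open>rho a - 1 / 8\<close> is at
    most 0.138. This is where \<open>b < 4\<close> and 263/1000 are used.\<close>
  have fl'b: "fl' b \<le> - (rho a - 1 / 8)"
  proof -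
    have "sqrt 3 ^ 2 \<le> b\<^sup>2"
      using bd by (intro power_mono) auto
    then have "1 \<le> (2 * b\<^sup>2 - 1) / (1 + b\<^sup>2)"
      using one_plus_sq_pos[of b] by (simp add: pos_le_divide_eq)
    then have "rho b * 1 \<le> rho b * ((2 * b\<^sup>2 - 1) / (1 + b\<^sup>2))"
      using rho_pos[of b] by (intro mult_left_mono) auto
    moreover have "rho b * ((2 * b\<^sup>2 - 1) / (1 + b\<^sup>2)) = - (rho b * (1 - 2 * b\<^sup>2) / (1 + b\<^sup>2))"
      by (simp add: algebra_simps minus_divide_left)
    ultimately have "rho b \<le> - (fl' b + 1 / 8)"
      by (simp add: fl'_def)
    then show ?thesis
      using ra rb4 by simp
  qed
  \<comment> \<open>Since \<open>rho a < D\<close> and \<open>rho b < 1 / 8\<close>, the factor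
    \<open>D - rho b\<close> exceeds \<open>rho a - 1 / 8\<close>, which is also a factor of
    \<open>fl a\<close> and cancels.\<close>
  have nd: "d \<le> nu a * a"
  proof -
    have "d * (rho a - 1 / 8) \<le> d * (D - rho b)"
      using d bd rb by (intro mult_left_mono) auto
    also have "\<dots> = nu a * a * (rho a - 1 / 8)"
      using n(1) by (simp add: fl_def mult.assoc)
    finally show ?thesis
      using ra by simp
  qed
  define P Q E G where "P = - (nu a * fl' a)" and "Q = - (nu a * fl' b)" and "E = d * gam b" and "G = d * gam a"
  have pos: "0 < P" "0 < Q" "0 < E" "0 < G"
    using n(3) d fl'_neg[of a] fl'_neg[of b] a a0 b gam_pos[of a] gam_pos[of b] p
    by (auto simp: P_def Q_def E_def G_def mult_pos_neg)
  have "G \<le> nu a * a * gam a"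
    unfolding G_def using nd gam_pos[OF a0] by (intro mult_right_mono) auto
  also have "\<dots> = nu a * (rho a - 1 / 8 - fl' a)"
    by (simp add: fl'_altdef)
  also have "\<dots> \<le> nu a * (- fl' b - fl' a)"
    using n(3) fl'b by (intro mult_left_mono) auto
  finally have PQ: "G \<le> P + Q"
    by (simp add: P_def Q_def algebra_simps)
  define X Y where "X = 2 / d ^ 3 + rho b" and "Y = 2 / d ^ 3 + rho a"
  have XY: "0 < X" "X < Y"
    using d rb ra rho_pos[of b] by (auto simp: X_def Y_def intro: add_pos_pos)
  have "jac_phi a = (P + E) * (Y - X) + (P + E + Q - G) * X + P * Q + E * G"
    by (simp add: jac_phi_def jac_def b_def[symmetric] d_def[symmetric] X_def Y_def P_def Q_def E_def G_def algebra_simps)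
  also have "\<dots> > 0"
    using pos PQ XY by (intro add_pos_pos mult_pos_pos) auto
  finally show ?thesis .
qed

section \<open>The single sign change and the minimum of \<open>nu\<close>\<close>

lemma jac_phi_neg: "0 < a \<Longrightarrow> a \<le> 29 / 50 \<Longrightarrow> jac_phi a < 0"
  using jac_phi_neg_small[of a] jac_phi_neg_middle[of a] by linarith

lemma jac_phi_pos: "13 / 20 \<le> a \<Longrightarrow> a < sqrt 3 \<Longrightarrow> 0 < jac_phi a"
  using jac_phi_pos_large[of a] jac_phi_pos_middle[of a] by linarith

lemma isCont_nu: "0 < a \<Longrightarrow> a < sqrt 3 \<Longrightarrow> isCont nu a"
  by (rule DERIV_isCont[OF has_derivative_nu])

lemma isCont_jac_phi:
  assumes "0 < a" "a < sqrt 3" shows "isCont jac_phi a"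
proof -
  have "phi a - a \<noteq> 0"
    using phi(1)[OF assms] by simp
  then show ?thesis
    unfolding jac_phi_def[abs_def] jac_def
    by (intro continuous_intros isCont_phi[OF assms] isCont_nu[OF assms] isCont_o2[OF isCont_phi[OF assms]]
        DERIV_isCont[OF has_derivative_rho] DERIV_isCont[OF has_derivative_fl'] DERIV_isCont[OF has_derivative_gam]) auto
qed

text \<open>All zeros of \<open>jac_phi\<close> lie between 29/50 and 13/20, where
  \<open>jac'_pos\<close> makes every crossing go upwards.\<close>

lemma jac_phi_pos_after:
  assumes "0 < x" "x < y" "y < sqrt 3" "0 \<le> jac_phi x" shows "0 < jac_phi y"
proof (rule pos_after_zero[where g = jac_phi and x = x and y = y])
  show "continuous_on {x..y} jac_phi"
    using assms by (intro continuous_at_imp_continuous_on ballI isCont_jac_phi) auto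
  fix z assume z: "x \<le> z" "z \<le> y" "jac_phi z = 0"
  then have "29 / 50 < z" "z < 13 / 20"
    using jac_phi_neg[of z] jac_phi_pos[of z] assms by force+
  then show "\<exists>D>0. (jac_phi has_real_derivative D) (at z)"
    using jac'_pos[of z] has_derivative_jac[of z] z assms by (auto simp: jac_phi_def[abs_def])
qed (use assms in auto)

lemma peak_in: "0 < peak_left" "peak_left < peak_right" "peak_right < sqrt 3"
  using less_sqrt3I[of peak_right] by (auto simp: peak_left_def peak_right_def)

lemma peak_ex: "\<exists>a. peak_left \<le> a \<and> a \<le> peak_right \<and> jac_phi a = 0"
  using peak_in jac_phi_peak_left jac_phi_peak_right
  by (intro IVT'[of jac_phi peak_left 0 peak_right])
    (auto intro!: continuous_at_imp_continuous_on isCont_jac_phi)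

definition peak :: real where
  "peak = (SOME a. peak_left \<le> a \<and> a \<le> peak_right \<and> jac_phi a = 0)"

lemma peak: "peak_left \<le> peak" "peak \<le> peak_right" "jac_phi peak = 0" "0 < peak" "peak < sqrt 3"
proof -
  show "peak_left \<le> peak" "peak \<le> peak_right" "jac_phi peak = 0"
    using someI_ex[OF peak_ex] by (auto simp: peak_def)
  then show "0 < peak" "peak < sqrt 3"
    using peak_in by auto
qed

lemma nu_decreasing:
  assumes "0 < x" "x < y" "y \<le> peak" shows "nu y < nu x"
proof (rule DERIV_neg_imp_decreasing_open[OF \<open>x < y\<close>])
  fix z assume z: "x < z" "z < y"
  then have z': "0 < z" "z < peak" "z < sqrt 3"
    using assms peak by auto
  then have "jac_phi z < 0"
    using jac_phi_pos_after[of z peak] peak by force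
  then show "\<exists>D. (nu has_real_derivative D) (at z) \<and> D < 0"
    using has_derivative_nu[of z] jac_den_pos[of z] z' by (auto simp: jac_phi_def divide_neg_pos)
next
  show "continuous_on {x..y} nu"
    using assms peak by (intro continuous_at_imp_continuous_on ballI isCont_nu) auto
qed

lemma nu_increasing:
  assumes "peak \<le> x" "x < y" "y < sqrt 3" shows "nu x < nu y"
proof (rule DERIV_pos_imp_increasing_open[OF \<open>x < y\<close>])
  fix z assume z: "x < z" "z < y"
  then have z': "0 < z" "peak < z" "z < sqrt 3"
    using assms peak by auto
  then have "0 < jac_phi z"
    using jac_phi_pos_after[of peak z] peak by force
  then show "\<exists>D. (nu has_real_derivative D) (at z) \<and> 0 < D"
    using has_derivative_nu[of z] jac_den_pos[of z] z' by (auto simp: jac_phi_def)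
next
  show "continuous_on {x..y} nu"
    using assms peak by (intro continuous_at_imp_continuous_on ballI isCont_nu) auto
qed

text \<open>The upper bound holds because \<open>nu\<close> decreases from \<open>peak_left\<close>
  to \<open>peak\<close>. For the lower one, the mean value theorem bounds the decrease by 10^-9
  times 2 * 10^-8, far below the slack of 7 * 10^-16 in the value at
  \<open>peak_left\<close>.\<close>

lemma nu_peak_bounds: "1994588026390975 / 10 ^ 15 < nu peak" "nu peak \<le> 1994588026390976 / 10 ^ 15"
proof -
  have "nu peak \<le> nu peak_left"
    using nu_decreasing[of peak_left peak] peak peak_in by (cases "peak = peak_left") auto
  then show "nu peak \<le> 1994588026390976 / 10 ^ 15"
    using nu_peak_left by linarith
  show "1994588026390975 / 10 ^ 15 < nu peak"
  proof (cases "peak = peak_left")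
    case True
    then show ?thesis
      using nu_peak_left by simp
  next
    case False
    then have lt: "peak_left < peak"
      using peak by simp
    have "\<exists>z. peak_left < z \<and> z < peak \<and> nu peak - nu peak_left =
       (peak - peak_left) * (jac_phi z / jac_den z (phi z) (nu z))"
      unfolding jac_phi_def
      using lt peak peak_in by (intro MVT2 has_derivative_nu) auto
    then obtain z where z: "peak_left < z" "z < peak" and
      eq: "nu peak - nu peak_left = (peak - peak_left) * (jac_phi z / jac_den z (phi z) (nu z))"
      by blast
    have zb: "\<bar>jac_phi z\<bar> \<le> 1 / 10 ^ 8" "1 / 2 \<le> jac_den z (phi z) (nu z)"
      using peak_bounds[of z] z peak by auto
    then have "\<bar>jac_phi z / jac_den z (phi z) (nu z)\<bar> \<le> (1 / 10 ^ 8) / (1 / 2)"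
      unfolding abs_divide by (intro frac_le) auto
    moreover have "\<bar>peak - peak_left\<bar> \<le> 1 / 10 ^ 9"
      using peak by (simp add: peak_left_def peak_right_def)
    ultimately have "\<bar>nu peak - nu peak_left\<bar> \<le> (1 / 10 ^ 9) * ((1 / 10 ^ 8) / (1 / 2))"
      unfolding eq abs_mult by (intro mult_mono) auto
    then show ?thesis
      using nu_peak_left(1) by (auto simp: abs_if split: if_splits)
  qed
qed

text \<open>\<open>nu a * fl a\<close> stays above 1/32 while \<open>fl a\<close> is at most
  \<open>a\<close>, so \<open>nu a\<close> is at least \<open>1 / (32 * a)\<close>; this dictates
  the witness.\<close>

lemma nu_unbounded_left: "\<exists>a. 0 < a \<and> a < peak \<and> c < nu a"
proof -
  define a where "a = min (1 / 8) (1 / (32 * (\<bar>c\<bar> + 1)))"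
  have a: "0 < a" "a \<le> 1 / 8" "a \<le> 1 / (32 * (\<bar>c\<bar> + 1))"
    by (auto simp: a_def)
  have a3: "a < sqrt 3"
    using a less_sqrt3I[of a] by simp
  define b where "b = phi a"
  define t where "t = 1 / b ^ 3"
  note bd = phi_bounds_small[OF a(1,2), folded b_def]
  have b2: "b\<^sup>2 < 3"
    using bd power_strict_mono[of b "sqrt 3" 2] by simp
  have b: "1 < b - a" "b < 2" "0 < b"
    using bd a real_less_lsqrt[of 2 3] by auto
  have "1 / 8 \<le> t"
    using b power_mono[of b 2 3] by (simp add: t_def divide_simps)
  \<comment> \<open>From \<open>b\<^sup>2 < 3\<close> follows
    \<open>(1 + b\<^sup>2) / b\<^sup>2 > 4 / 3\<close>, so \<open>rho b\<close> is below
    \<open>b\<close> to the power -3 by a fixed factor and at least \<open>t / 4\<close> remains in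
    the difference.\<close>
  have "rho b \<le> 3 / 4 * t"
  proof (rule rho_le)
    define y where "y = ((1 + b\<^sup>2) / b\<^sup>2) ^ 3"
    have "(4 / 3) ^ 3 \<le> y"
      unfolding y_def using b2 b by (intro power_mono) (simp_all add: field_simps)
    then have "1 \<le> 9 / 16 * y"
      by (simp add: power_divide)
    also have "\<dots> = (3 / 4 * t)\<^sup>2 * (1 + b\<^sup>2) ^ 3"
      using b by (simp add: y_def t_def power_divide power_mult_distrib power_mult[symmetric])
    finally show "1 \<le> (3 / 4 * t)\<^sup>2 * (1 + b\<^sup>2) ^ 3" .
  qed (use \<open>1 / 8 \<le> t\<close> in simp)
  moreover have "t \<le> 1 / (b - a) ^ 3"
    unfolding t_def using b a by (intro divide_left_mono power_mono mult_pos_pos) auto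
  ultimately have "1 / 32 \<le> 1 / (b - a) ^ 3 - rho b"
    using \<open>1 / 8 \<le> t\<close> by linarith
  then have "1 * (1 / 32) \<le> (b - a) * (1 / (b - a) ^ 3 - rho b)"
    using b by (intro mult_mono) auto
  also have "\<dots> = nu a * fl a"
    using nu(1)[OF a(1) a3] by (simp add: b_def)
  also have "\<dots> \<le> nu a * a"
  proof -
    have "rho a - 1 / 8 \<le> 1"
      using rho_le[of 1 a] by simp
    then have "a * (rho a - 1 / 8) \<le> a * 1"
      using a by (intro mult_left_mono) auto
    then show ?thesis
      using nu(3)[OF a(1) a3] by (simp add: fl_def)
  qed
  finally have "1 / 32 \<le> nu a * a" by simp
  moreover have "a * (\<bar>c\<bar> + 1) \<le> 1 / 32"
    using a(3) by (simp add: field_simps)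
  ultimately have "a * (\<bar>c\<bar> + 1) \<le> a * nu a"
    by (simp add: mult.commute)
  then have "\<bar>c\<bar> + 1 \<le> nu a"
    using a(1) by simp
  then show ?thesis
    using a peak(1) by (intro exI[of _ a]) (auto simp: peak_left_def)
qed

text \<open>The product is \<open>1 / d\<^sup>2 - d * rho b\<close> with
  \<open>d = phi a - a\<close>, so what matters is an upper bound for \<open>d\<close>.\<close>

lemma nu_fl_large:
  assumes a: "8 / 5 \<le> a" "a < sqrt 3" shows "1 / 4 \<le> nu a * fl a"
proof -
  have a0: "0 < a" "6 / 5 \<le> a" using a by auto
  define b where "b = phi a"
  define d where "d = b - a"
  note p = phi[OF a0(1) a(2), folded b_def]
  note z = kcurve_zero[OF a0(1) a(2) p, folded d_def]
  note bd = phi_bounds_large[OF a0(2) a(2), folded b_def, folded d_def]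
  have "rho (8 / 5) \<le> 15 / 100"
    by (rule rho_le) (simp_all add: power_divide)
  then have "fl (8 / 5) \<le> 4 / 100"
    by (simp add: fl_def)
  then have fla: "fl a \<le> 4 / 100"
    using fl_antimono[of "8 / 5" a] a by simp
  \<comment> \<open>For \<open>b\<close> at least 3 the negative \<open>fl b\<close> would outweigh
    \<open>fl a\<close>, which is at most 4/100 here, against
    \<open>fl a + fl b > 0\<close>.\<close>
  have b3: "b < 3"
  proof (rule ccontr)
    assume b: "\<not> b < 3"
    then have "rho b < 1 / 3 ^ 3"
      by (intro rho_less_inverse_cube) auto
    then have "3 * (1 / 8 - 1 / 27) \<le> b * (1 / 8 - rho b)"
      using b by (intro mult_mono) auto
    then show False
      using z(4) fla by (simp add: fl_def algebra_simps)
  qed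
  have d: "0 < d" "d \<le> 7 / 5"
    using p b3 a by (auto simp: d_def)
  have "rho b \<le> 1 / 8"
    using rho_less_iff[of "sqrt 3" b] bd p a0 by (simp add: rho_sqrt3)
  then have "d * rho b \<le> 7 / 5 * (1 / 8)"
    using d rho_pos[of b] by (intro mult_mono) auto
  moreover have "1 / (7 / 5)\<^sup>2 \<le> 1 / d\<^sup>2"
    using d by (intro divide_left_mono power_mono) auto
  moreover have "d * (1 / d ^ 3) = 1 / d\<^sup>2"
    using d by (simp add: field_simps eval_nat_numeral)
  ultimately have "1 / 4 \<le> d * (1 / d ^ 3 - rho b)"
    unfolding right_diff_distrib by (simp add: power_divide)
  then show ?thesis
    using nu(1)[OF a0(1) a(2)] by (simp add: b_def d_def)
qed

lemma nu_unbounded_right: "\<exists>a. peak < a \<and> a < sqrt 3 \<and> c < nu a"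
proof -
  have "fl (sqrt 3) < 1 / (4 * (\<bar>c\<bar> + 1))"
    by (simp add: fl_def rho_sqrt3)
  then have "\<forall>\<^sub>F a in at (sqrt 3). fl a < 1 / (4 * (\<bar>c\<bar> + 1))"
    using DERIV_isCont[OF has_derivative_fl, of "sqrt 3"] unfolding isCont_def by (rule order_tendstoD(2)[rotated])
  then have "\<forall>\<^sub>F a in at_left (sqrt 3). fl a < 1 / (4 * (\<bar>c\<bar> + 1))"
    by (simp add: eventually_at_split)
  moreover have s3: "8 / 5 < sqrt 3"
    by (rule real_less_rsqrt) (simp add: power_divide)
  then have "\<forall>\<^sub>F a in at_left (sqrt 3). a \<in> {8 / 5<..<sqrt 3}"
    by (rule eventually_at_left_real)
  ultimately have "\<forall>\<^sub>F a in at_left (sqrt 3). fl a < 1 / (4 * (\<bar>c\<bar> + 1)) \<and> a \<in> {8 / 5<..<sqrt 3}"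
    by eventually_elim simp
  then obtain a where a: "fl a < 1 / (4 * (\<bar>c\<bar> + 1))" "8 / 5 < a" "a < sqrt 3"
    using eventually_happens'[OF trivial_limit_at_left_real] by fastforce
  have pos: "0 < fl a"
    using fl_sign(1)[of a] a by simp
  have "fl a * (\<bar>c\<bar> + 1) \<le> 1 / 4"
    using a(1) by (simp add: field_simps)
  also have "\<dots> \<le> fl a * nu a"
    using nu_fl_large[of a] a by (simp add: mult.commute)
  finally have "\<bar>c\<bar> + 1 \<le> nu a"
    using pos by simp
  then show ?thesis
    using a peak(2) by (intro exI[of _ a]) (auto simp: peak_right_def)
qed

section \<open>Central configurations\<close>

lemma sum_bodies: "(\<Sum>i\<in>bodies. F i) = F 1 + F 2 + F 3 + (F 4 :: 'a::comm_monoid_add)"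
  by (simp add: bodies_def add.assoc)

text \<open>Body 1 appears as \<open>Suc 0\<close>, the form to which the simplifier brings the
  numeral.\<close>

lemma bodies_remove:
  "bodies - {Suc 0} = {2, 3, 4}" "bodies - {2} = {1, 3, 4}" "bodies - {3} = {1, 2, 4}" "bodies - {4} = {1, 2, 3}"
  by (auto simp: bodies_def)

lemma center_kite:
  "center_of_mass (kite_masses m) (kite_config a b) = \<i> * of_real (m * (a + b) / (2 + 2 * m))"
  unfolding center_of_mass_def sum_bodies
  by (simp add: kite_masses_def kite_config_def field_simps)

lemma cmod_side:
  "cmod (- 1 - \<i> * of_real x) = sqrt (1 + x\<^sup>2)" "cmod (1 - \<i> * of_real x) = sqrt (1 + x\<^sup>2)"
  "cmod (\<i> * of_real x + 1) = sqrt (1 + x\<^sup>2)" "cmod (\<i> * of_real x - 1) = sqrt (1 + x\<^sup>2)"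
  "cmod (1 + \<i> * of_real x) = sqrt (1 + x\<^sup>2)"
  by (simp_all add: cmod_def)

lemma inverse_cube_side: "x / sqrt (1 + y\<^sup>2) ^ 3 = x * rho y"
  by (simp add: rho_def)

lemma cmod_axis: "a < b \<Longrightarrow> cmod (\<i> * of_real a - \<i> * of_real b) = b - a"
  "a < b \<Longrightarrow> cmod (\<i> * of_real b - \<i> * of_real a) = b - a"
  by (simp_all add: cmod_def power2_commute[of a b])

text \<open>On the left stand the equations of the base bodies, horizontal and vertical, and of the
  two axis bodies, for the multiplier \<open>l\<close>; \<open>c\<close> is the height of the centre
  of mass. The equations for \<open>l * (a + b)\<close> and \<open>l * (b - a)\<close> are free of
  \<open>c\<close>, and inserting the value of \<open>l\<close> leaves the two equations on the
  right.\<close>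

lemma reduced_equations:
  fixes a b m c R S D :: real
  assumes m: "0 < m" and c: "c * (2 + 2 * m) = m * (a + b)"
  shows "(\<exists>l. l = 1 / 4 + m * R + m * S \<and> l * c = m * (a * R + b * S) \<and>
      l * (a - c) = 2 * a * R - m * D * (b - a) \<and> l * (b - c) = 2 * b * S + m * D * (b - a)) \<longleftrightarrow>
    m * ((b - a) * (D - S)) = 2 * (a * (R - 1 / 8)) \<and> m * ((b - a) * (R - D)) = 2 * (b * (S - 1 / 8))"
    (is "?L \<longleftrightarrow> ?R")
proof
  assume ?L
  then obtain l where l: "l = 1 / 4 + m * R + m * S" "l * c = m * (a * R + b * S)"
    "l * (a - c) = 2 * a * R - m * D * (b - a)" "l * (b - c) = 2 * b * S + m * D * (b - a)"
    by blast
  have "m * (l * (a + b)) = l * (c * (2 + 2 * m))"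
    unfolding c by simp
  also have "\<dots> = (l * c) * (2 + 2 * m)"
    by simp
  also have "\<dots> = m * ((2 + 2 * m) * (a * R + b * S))"
    unfolding l(2) by simp
  finally have 1: "l * (a + b) = (2 + 2 * m) * (a * R + b * S)"
    using m by simp
  have 2: "l * (b - a) = 2 * b * S - 2 * a * R + 2 * m * D * (b - a)"
    using l(3,4) by (simp add: algebra_simps)
  show ?R
    using 1 2 unfolding l(1) by (simp add: field_simps; linarith)
next
  assume ?R
  define l where "l = 1 / 4 + m * R + m * S"
  have 1: "l * (a + b) = (2 + 2 * m) * (a * R + b * S)"
    using \<open>?R\<close> unfolding l_def by (simp add: field_simps; linarith)
  have 2: "l * (b - a) = 2 * b * S - 2 * a * R + 2 * m * D * (b - a)"
    using \<open>?R\<close> unfolding l_def by (simp add: field_simps; linarith)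
  have "(l * c) * (2 + 2 * m) = l * (c * (2 + 2 * m))"
    by simp
  also have "\<dots> = m * (l * (a + b))"
    unfolding c by simp
  also have "\<dots> = (m * (a * R + b * S)) * (2 + 2 * m)"
    unfolding 1 by simp
  finally have 3: "l * c = m * (a * R + b * S)"
    using m by simp
  then have "l * (a - c) = 2 * a * R - m * D * (b - a) \<and> l * (b - c) = 2 * b * S + m * D * (b - a)"
    using 1 2 by (simp add: algebra_simps; linarith)
  then show ?L
    using 3 l_def by blast
qed

lemma central_kite_iff:
  assumes "0 < m" "0 < a" "a < b"
  shows "central_configuration (kite_masses m) (kite_config a b) \<longleftrightarrow>
    m * ((b - a) * (1 / (b - a) ^ 3 - rho b)) = 2 * fl a \<and>
    m * ((b - a) * (rho a - 1 / (b - a) ^ 3)) = 2 * fl b"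
proof -
  define c where "c = m * (a + b) / (2 + 2 * m)"
  have c: "c * (2 + 2 * m) = m * (a + b)"
    using assms by (simp add: c_def)
  have dist: "\<forall>i\<in>bodies. \<forall>j\<in>bodies. i \<noteq> j \<longrightarrow> kite_config a b i \<noteq> kite_config a b j"
    using assms by (auto simp: bodies_def kite_config_def complex_eq_iff)
  define P where "P l j \<longleftrightarrow> - of_real (l * kite_masses m j) * (kite_config a b j - \<i> * of_real c) =
    (\<Sum>i\<in>bodies - {j}. of_real (kite_masses m i * kite_masses m j / cmod (kite_config a b i - kite_config a b j) ^ 3) *
      (kite_config a b i - kite_config a b j))" for l j
  define D where "D = 1 / (b - a) ^ 3"
  have D: "x / (b - a) ^ 3 = x * D" for x
    by (simp add: D_def)
  note eqs = bodies_remove kite_masses_def kite_config_def complex_eq_iff cmod_side cmod_axis inverse_cube_side D assms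
  have "central_configuration (kite_masses m) (kite_config a b) \<longleftrightarrow> (\<exists>l. P l 1 \<and> P l 2 \<and> P l 3 \<and> P l 4)"
    unfolding central_configuration_def center_kite c_def[symmetric] P_def[symmetric]
    using dist by (simp add: bodies_def)
  moreover have "P l 1 \<longleftrightarrow> l = 1 / 4 + m * rho a + m * rho b \<and> l * c = m * (a * rho a + b * rho b)" for l
    unfolding P_def by (auto simp: eqs algebra_simps)
  moreover have "P l 2 \<longleftrightarrow> l = 1 / 4 + m * rho a + m * rho b \<and> l * c = m * (a * rho a + b * rho b)" for l
    unfolding P_def by (auto simp: eqs algebra_simps)
  moreover have "P l 3 \<longleftrightarrow> l * (a - c) = 2 * a * rho a - m * D * (b - a)" for l
  proof -
    \<comment> \<open>The equation of an axis body carries its own mass as a common factor,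
      cancelled since \<open>m\<close> is positive.\<close>
    have "P l 3 \<longleftrightarrow> m * (l * (a - c)) = m * (2 * a * rho a - m * D * (b - a))"
      unfolding P_def by (auto simp: eqs algebra_simps)
    then show ?thesis using assms by simp
  qed
  moreover have "P l 4 \<longleftrightarrow> l * (b - c) = 2 * b * rho b + m * D * (b - a)" for l
  proof -
    have "P l 4 \<longleftrightarrow> m * (l * (b - c)) = m * (2 * b * rho b + m * D * (b - a))"
      unfolding P_def by (auto simp: eqs algebra_simps)
    then show ?thesis using assms by simp
  qed
  ultimately have "central_configuration (kite_masses m) (kite_config a b) \<longleftrightarrow>
    (\<exists>l. l = 1 / 4 + m * rho a + m * rho b \<and> l * c = m * (a * rho a + b * rho b) \<and>
      l * (a - c) = 2 * a * rho a - m * D * (b - a) \<and> l * (b - c) = 2 * b * rho b + m * D * (b - a))"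
    by blast
  then show ?thesis
    unfolding reduced_equations[OF assms(1) c] by (simp add: fl_def D_def)
qed


lemma not_collinear_base:
  assumes "0 < b" shows "\<not> collinear {-1, 1, \<i> * of_real b}"
proof
  assume "collinear {-1, 1, \<i> * complex_of_real b}"
  then obtain u where u: "\<forall>x\<in>{-1, 1, \<i> * complex_of_real b}. \<forall>y\<in>{-1, 1, \<i> * complex_of_real b}. \<exists>c. x - y = c *\<^sub>R u"
    unfolding collinear_def by blast
  then obtain c d where "1 - (-1) = c *\<^sub>R u" "\<i> * complex_of_real b - 1 = d *\<^sub>R u"
    by blast
  then have "2 = c * Re u" "0 = c * Im u" "b = d * Im u"
    by (simp_all add: complex_eq_iff)
  then show False
    using assms by auto
qed

text \<open>Interior points are those with positive barycentric coordinates; a point on the axis has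
  equal weights at the two base bodies.\<close>

lemma in_interior_base_iff:
  assumes "0 < b"
  shows "\<i> * of_real a \<in> interior (convex hull {-1, 1, \<i> * of_real b}) \<longleftrightarrow> 0 < a \<and> a < b"
proof -
  have "interior (convex hull {-1, 1, \<i> * complex_of_real b}) =
      {v. \<exists>x y z. 0 < x \<and> 0 < y \<and> 0 < z \<and> x + y + z = 1 \<and> x *\<^sub>R (-1) + y *\<^sub>R 1 + z *\<^sub>R (\<i> * of_real b) = v}"
    by (rule interior_convex_hull_3_minimal[OF not_collinear_base[OF assms]]) simp
  then have "\<i> * of_real a \<in> interior (convex hull {-1, 1, \<i> * of_real b}) \<longleftrightarrow>
      (\<exists>x y z. 0 < x \<and> 0 < y \<and> 0 < z \<and> x + y + z = 1 \<and> y = x \<and> z * b = a)"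
    by (auto simp: complex_eq_iff)
  also have "\<dots> \<longleftrightarrow> 0 < a \<and> a < b"
  proof
    assume "0 < a \<and> a < b"
    then show "\<exists>x y z. 0 < x \<and> 0 < y \<and> 0 < z \<and> x + y + z = 1 \<and> y = x \<and> z * b = a"
      using assms by (intro exI[of _ "(1 - a / b) / 2"] exI[of _ "a / b"]) (auto simp: field_simps)
  next
    assume "\<exists>x y z. 0 < x \<and> 0 < y \<and> 0 < z \<and> x + y + z = 1 \<and> y = x \<and> z * b = a"
    then obtain x z where "0 < x" "0 < z" "x + x + z = 1" "z * b = a"
      by auto
    then show "0 < a \<and> a < b"
      using assms by (auto intro: mult_pos_pos mult_less_cancel_right2[THEN iffD2])
  qed
  finally show ?thesis .
qed

text \<open>Counting configurations becomes counting the points of a level set of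
  \<open>nu\<close>.\<close>

lemma ccs_eq:
  assumes "0 < m"
  shows "concave_kite_ccs m = (\<lambda>a. (a, phi a)) ` {a. 0 < a \<and> a < sqrt 3 \<and> nu a = 2 / m}"
proof -
  have "(a, b) \<in> concave_kite_ccs m \<longleftrightarrow> 0 < a \<and> a < sqrt 3 \<and> nu a = 2 / m \<and> b = phi a" for a b
  proof -
    let ?d = "b - a" and ?D = "1 / (b - a) ^ 3"
    have "(a, b) \<in> concave_kite_ccs m \<longleftrightarrow> 0 < a \<and> a < b \<and>
       m * (?d * (?D - rho b)) = 2 * fl a \<and> m * (?d * (rho a - ?D)) = 2 * fl b"
      using in_interior_base_iff[of b a] central_kite_iff[OF assms, of a b]
      by (auto simp: concave_kite_ccs_def kite_config_def)
    also have "\<dots> \<longleftrightarrow> 0 < a \<and> a < sqrt 3 \<and> nu a = 2 / m \<and> b = phi a"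
    proof
      assume *: "0 < a \<and> a < b \<and> m * (?d * (?D - rho b)) = 2 * fl a \<and> m * (?d * (rho a - ?D)) = 2 * fl b"
      \<comment> \<open>Positivity of the left side of the first equation forces
        \<open>fl a > 0\<close>, which is where \<open>a < sqrt 3\<close> comes from.\<close>
      then have "0 < m * (?d * (?D - rho b))"
        using * assms rho_less_inverse_cube[of "b - a" b] by (intro mult_pos_pos) auto
      then have fa: "0 < fl a"
        using * by linarith
      then have a3: "a < sqrt 3"
        using * fl_sign(1)[of a] by auto
      have "(m * ?d) * kcurve a b = fl a * (m * (?d * (rho a - ?D))) - fl b * (m * (?d * (?D - rho b)))"
        unfolding kcurve_def by (simp only: ring_distribs right_diff_distrib left_diff_distrib mult_ac)
      also have "\<dots> = 0"
        using * by simp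
      finally have "kcurve a b = 0"
        using * assms by auto
      then have b: "b = phi a"
        using phi_eqI * a3 by blast
      moreover have "?d * (?D - rho b) = 2 * fl a / m"
        using * assms by (simp add: nonzero_eq_divide_eq mult.commute)
      then have "nu a = 2 / m"
        using fa unfolding nu_def b[symmetric] by simp
      ultimately show "0 < a \<and> a < sqrt 3 \<and> nu a = 2 / m \<and> b = phi a"
        using * a3 by blast
    next
      assume *: "0 < a \<and> a < sqrt 3 \<and> nu a = 2 / m \<and> b = phi a"
      then have "?d * (?D - rho b) = 2 / m * fl a" "?d * (rho a - ?D) = 2 / m * fl b"
        using nu(1,2)[of a] by auto
      then show "0 < a \<and> a < b \<and> m * (?d * (?D - rho b)) = 2 * fl a \<and> m * (?d * (rho a - ?D)) = 2 * fl b"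
        using * phi(1)[of a] assms by auto
    qed
    finally show ?thesis .
  qed
  then show ?thesis
    by auto
qed

lemma nu_ge_peak:
  assumes "0 < a" "a < sqrt 3" shows "nu peak \<le> nu a" "nu a = nu peak \<longleftrightarrow> a = peak"
  using nu_decreasing[of a peak] nu_increasing[of peak a] assms by (cases a peak rule: linorder_cases; force)+

text \<open>On each side of \<open>peak\<close> the blow-up of \<open>nu\<close> gives a solution
  and strict monotonicity its uniqueness.\<close>

lemma nu_level_set:
  assumes "nu peak < c"
  shows "\<exists>x y. x < y \<and> {a. 0 < a \<and> a < sqrt 3 \<and> nu a = c} = {x, y}"
proof -
  obtain l where l: "0 < l" "l < peak" "c < nu l"
    using nu_unbounded_left by blast
  obtain r where r: "peak < r" "r < sqrt 3" "c < nu r"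
    using nu_unbounded_right by blast
  have cont: "continuous_on {p..q} nu" if "0 < p" "q < sqrt 3" for p q
    using that by (intro continuous_at_imp_continuous_on ballI isCont_nu) auto
  obtain x where x: "l \<le> x" "x \<le> peak" "nu x = c"
    using IVT2'[of nu peak c l] l assms cont[OF l(1) peak(5)] by auto
  obtain y where y: "peak \<le> y" "y \<le> r" "nu y = c"
    using IVT'[of nu peak c r] r assms cont[OF peak(4) r(2)] by auto
  have "x < peak" "peak < y"
    using x y assms by (auto simp: less_le)
  moreover have "a = x" if "0 < a" "a \<le> peak" "nu a = c" for a
    using nu_decreasing[of a x] nu_decreasing[of x a] that x l by (cases a x rule: linorder_cases) auto
  moreover have "a = y" if "peak \<le> a" "a < sqrt 3" "nu a = c" for a
    using nu_increasing[of a y] nu_increasing[of y a] that y r by (cases a y rule: linorder_cases) auto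
  ultimately have "a = x \<or> a = y" if "0 < a" "a < sqrt 3" "nu a = c" for a
    using that linear[of a peak] by blast
  moreover have "0 < x" "x < sqrt 3" "0 < y" "y < sqrt 3"
    using x y l r peak(4,5) by auto
  ultimately have "{a. 0 < a \<and> a < sqrt 3 \<and> nu a = c} = {x, y}"
    using x(3) y(3) by blast
  then show ?thesis
    using \<open>x < peak\<close> \<open>peak < y\<close> by (intro exI[of _ x] exI[of _ y]) simp
qed

text \<open>With massless axis bodies the centre of mass is the origin and the base bodies fix the
  multiplier to 1/4; each axis body is then a separate equilibrium problem,
  \<open>a = 2 * a * rho a * 4\<close>.\<close>

lemma massless_kite_iff:
  assumes "0 < b"
  shows "central_configuration0 (kite_masses 0) (kite_config a b) \<longleftrightarrow> (a = 0 \<or> rho a = 1 / 8) \<and> rho b = 1 / 8"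
proof -
  have center: "center_of_mass (kite_masses 0) (kite_config a b) = 0"
    unfolding center_kite by simp
  have massive: "{i \<in> bodies - {j}. kite_masses 0 i \<noteq> 0} = {1, 2} - {j}" for j
    by (auto simp: bodies_def kite_masses_def)
  have dist: "\<forall>i\<in>bodies. \<forall>j\<in>bodies. i \<noteq> j \<and> (kite_masses 0 i \<noteq> 0 \<or> kite_masses 0 j \<noteq> 0) \<longrightarrow>
      kite_config a b i \<noteq> kite_config a b j"
    by (auto simp: bodies_def kite_masses_def kite_config_def complex_eq_iff)
  define P where "P l j \<longleftrightarrow> - of_real l * (kite_config a b j - 0) =
    (\<Sum>i\<in>{1, 2} - {j}. of_real (kite_masses 0 i / cmod (kite_config a b i - kite_config a b j) ^ 3) *
      (kite_config a b i - kite_config a b j))" for l j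
  have remove: "{Suc 0, 2} - {Suc 0} = {2}" "{Suc 0, 2} - {2} = {Suc 0}"
    "{Suc 0, 2} - {3} = {Suc 0, 2}" "{Suc 0, 2} - {4} = {Suc 0, 2}"
    by auto
  note eqs = remove kite_masses_def kite_config_def complex_eq_iff cmod_side inverse_cube_side
  have "central_configuration0 (kite_masses 0) (kite_config a b) \<longleftrightarrow> (\<exists>l. P l 1 \<and> P l 2 \<and> P l 3 \<and> P l 4)"
    unfolding central_configuration0_def center massive P_def[symmetric]
    using dist by (simp add: bodies_def)
  moreover have "P l 1 \<longleftrightarrow> l = 1 / 4" "P l 2 \<longleftrightarrow> l = 1 / 4" for l
    unfolding P_def by (auto simp: eqs)
  moreover have "P l 3 \<longleftrightarrow> l * a = 2 * a * rho a" "P l 4 \<longleftrightarrow> l * b = 2 * b * rho b" for l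
    unfolding P_def by (auto simp: eqs algebra_simps)
  ultimately show ?thesis
    using assms by auto
qed

lemma rho_eq_eighth_iff: "rho x = 1 / 8 \<longleftrightarrow> \<bar>x\<bar> = sqrt 3"
proof -
  have "rho x = rho \<bar>x\<bar>"
    by (simp add: rho_def)
  then show ?thesis
    using rho_less_iff[of "\<bar>x\<bar>" "sqrt 3"] rho_less_iff[of "sqrt 3" "\<bar>x\<bar>"]
    by (cases "\<bar>x\<bar>" "sqrt 3" rule: linorder_cases) (auto simp: rho_sqrt3)
qed

text \<open>The equilibria are 0 and plus or minus \<open>sqrt 3\<close>; the hull lies in the upper
  half plane, which excludes \<open>a = - sqrt 3\<close> and leaves the midpoint of the base and the
  apex.\<close>

lemma ccs0_eq: "concave_kite_ccs0 = {(0, sqrt 3), (sqrt 3, sqrt 3)}"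
proof -
  have hull: "0 \<le> a" if "\<i> * of_real a \<in> convex hull {-1, 1, \<i> * of_real b}" "0 < b" for a b
    using that by (auto simp: convex_hull_3 complex_eq_iff)
  have mid: "0 \<in> convex hull {-1, 1, \<i> * complex_of_real b}" for b
  proof -
    have "(1 / 2) *\<^sub>R (-1) + (1 / 2) *\<^sub>R 1 + 0 *\<^sub>R (\<i> * complex_of_real b) \<in> convex hull {-1, 1, \<i> * complex_of_real b}"
      unfolding convex_hull_3
      by (intro CollectI exI[of _ "1 / 2"] exI[of _ "0::real"] conjI refl) auto
    then show ?thesis by simp
  qed
  have top: "\<i> * of_real b \<in> convex hull {-1, 1, \<i> * of_real b}" for b
    by (rule hull_inc) simp
  have "(a, b) \<in> concave_kite_ccs0 \<longleftrightarrow> b = sqrt 3 \<and> (a = 0 \<or> a = sqrt 3)" for a b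
  proof -
    have "(a, b) \<in> concave_kite_ccs0 \<longleftrightarrow> 0 < b \<and> \<i> * of_real a \<in> convex hull {-1, 1, \<i> * of_real b} \<and>
        (a = 0 \<or> \<bar>a\<bar> = sqrt 3) \<and> \<bar>b\<bar> = sqrt 3"
      using massless_kite_iff[of b a, unfolded rho_eq_eighth_iff]
      by (auto simp: concave_kite_ccs0_def kite_config_def)
    also have "\<dots> \<longleftrightarrow> b = sqrt 3 \<and> (a = 0 \<or> a = sqrt 3)"
      using hull[of a b] mid[of "sqrt 3"] top[of "sqrt 3"] by (auto simp: abs_if split: if_splits)
    finally show ?thesis .
  qed
  then show ?thesis
    by auto
qed

theorem theorem2:
  "\<exists>m0::real. 1.00271332903708 < m0 \<and> m0 < 1.00271332903709 \<and>
     (\<forall>m. 0 < m \<and> m < m0 \<longrightarrow> card (concave_kite_ccs m) = 2) \<and>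
     card (concave_kite_ccs m0) = 1 \<and>
     (\<forall>m. m > m0 \<longrightarrow> concave_kite_ccs m = {}) \<and>
     concave_kite_ccs0 = {(0, sqrt 3), (sqrt 3, sqrt 3)}"
proof -
  define m0 where "m0 = 2 / nu peak"
  have pos: "0 < nu peak" "0 < m0"
    using nu(3) peak by (auto simp: m0_def)
  have card: "card (concave_kite_ccs m) = card {a. 0 < a \<and> a < sqrt 3 \<and> nu a = 2 / m}" if "0 < m" for m
    unfolding ccs_eq[OF that] by (rule card_image) (auto simp: inj_on_def)
  have "card (concave_kite_ccs m) = 2" if "0 < m \<and> m < m0" for m
  proof -
    have "nu peak < 2 / m"
      using that pos by (simp add: m0_def field_simps)
    then show ?thesis
      using nu_level_set card that by force
  qed
  moreover have "card (concave_kite_ccs m0) = 1"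
  proof -
    have "{a. 0 < a \<and> a < sqrt 3 \<and> nu a = 2 / m0} = {peak}"
      using nu_ge_peak(2) peak pos by (auto simp: m0_def)
    then show ?thesis
      using card[of m0] pos by simp
  qed
  moreover have "concave_kite_ccs m = {}" if "m > m0" for m
  proof -
    have "0 < m"
      using that pos by linarith
    moreover have "2 < nu peak * m"
      using that pos by (simp add: m0_def field_simps)
    ultimately have "2 / m < nu peak"
      by (simp add: pos_divide_less_eq)
    then show ?thesis
      using nu_ge_peak(1) \<open>0 < m\<close> by (force simp: ccs_eq)
  qed
  moreover have "1.00271332903708 < m0" "m0 < 1.00271332903709"
    using nu_peak_bounds pos by (simp_all add: m0_def field_simps)
  ultimately show ?thesis
    using ccs0_eq by blast
qed

end
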